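(* Let $\overline{w}$ be a band from a gentle pair $(Q,I)$ with associated band graph $\widetilde{\mathcal{G}}(\overline{w})$. Then, for $\lambda\in K^\times$, there is a lattice bijection between the lattice of good matchings of $\widetilde{\mathcal{G}}(\overline{w})$ and the canonical submodule lattice of $M(\overline{w},\lambda,1)$.
   Context: $K$ is an algebraically closed field. A gentle pair $(Q,I)$: $Q$ is a finite quiver, $KQ/I$ is finite dimensional, $I$ is generated by paths of length two, each vertex has at most two incoming and two outgoing arrows, and for each arrow $\beta$ there is at most one arrow $\alpha$ with $\alpha\beta$ a path not in $I$, at most one with $\alpha\beta$ a path in $I$, at most one $\gamma$ with $\beta\gamma$ a path not in $I$, at most one with $\beta\gamma$ a path in $I$. Paths compose left to right. Each arrow $\alpha$ has a formal inverse $\alpha^{-1}$ with $s,t$ exchanged. A walk is a word $\alpha_1^{\epsilon_1}\cdots\alpha_m^{\epsilon_m}$ in arrows ($\epsilon=+$) and inverse arrows ($\epsilon=-$), consecutive letters composable and no letter followed by its inverse. A string is a walk with no subword $u$ such that $u$ or $u^{-1}$ is a relation in $I$. A band is a nontrivial walk $\overline{w}$ all of whose powers are strings and which is not a power of a shorter string. For $\overline{w}=\alpha_1^{\epsilon_1}\cdots\alpha_m^{\epsilon_m}$ put $\overline{w}(i)=s(\alpha_i^{\epsilon_i})$. The band module $M(\overline{w},\lambda,1)$ has canonical basis $z_1,\dots,z_m$ with $z_i$ at vertex $\overline{w}(i)$; for $i<m$ the arrow $\alpha_i$ sends $z_i\mapsto z_{i+1}$ if $\epsilon_i=+$ and $z_{i+1}\mapsto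 z_i$ if $\epsilon_i=-$; $\alpha_m$ sends $z_m\mapsto\lambda z_1$ if $\epsilon_m=+$ and $z_1\mapsto\lambda z_m$ if $\epsilon_m=-$. Canonical submodules are the submodules spanned by subsets of the canonical basis, ordered by inclusion. Snake graph $\mathcal{G}$ of the string $\alpha_1^{\epsilon_1}\cdots\alpha_{m-1}^{\epsilon_{m-1}}$: it has square tiles $G_1,\dots,G_m$, $G_i$ labeled $\overline{w}(i)$. If $\epsilon_1=+$ glue $G_2$ on the north edge of $G_1$, otherwise on the east edge; for $2\le i\le m-1$ glue $G_{i+1}$ on the north or east edge of $G_i$ so that $G_{i-1},G_i,G_{i+1}$ share a common vertex iff $\epsilon_{i-1}=\epsilon_i$. Write $N,E,S,W(G_i)$ for the north, east, south, west edges. The band graph $\widetilde{\mathcal{G}}(\overline{w})$ is obtained from $\mathcal{G}$ by gluing: $W(G_1)$ to $E(G_m)$ if $\epsilon_m=+$, $m$ even; $W(G_1)$ to $N(G_m)$ if $\epsilon_m=+$, $m$ odd; $S(G_1)$ to $N(G_m)$ if $\epsilon_m=-$, $m$ even; $S(G_1)$ to $E(G_m)$ if $\epsilon_m=-$, $m$ odd. A good matching of the band graph is a perfect matching such that either the glued (cut) edge is in it, or the two matching edges incident to the endpoints of the cut edge lie on the same side of the cut edge. Good matchings are identified with perfect matchings of $\mathcal{G}$ containing at least one of the two edges that are glued. The minimal matching $P_-$ of $\mathcal{G}$ is the perfect matching using only boundary edges (edges bordering exactly one tile) and containing $S(G_1)$. For a perfect matching $P$ of $\mathcal{G}$, $P\ominus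 P_-$ (symmetric difference) is the boundary of a union of tiles; let $\mathbf{h}(P)\in\{0,1\}^m$ indicate which tiles are in this union. Good matchings are ordered by $P_1\le P_2$ iff $\mathbf{h}(P_1)\le\mathbf{h}(P_2)$ componentwise; this gives a distributive lattice. A lattice bijection is a bijection that is an isomorphism of lattices. *)

theory Defs
  imports
    "HOL-Computational_Algebra.Polynomial"
    "HOL-Library.Function_Algebras"
    "HOL-Library.Sublist"
    "HOL-Algebra.Ideal"
    "HOL-Algebra.Lattice"
    "Graph_Theory.Digraph"
    "Graph_Theory.Arc_Walk"
begin

section \<open>Function spaces and lattice isomorphisms\<close>

definition fscale :: "'k::field \<Rightarrow> ('x \<Rightarrow> 'k) \<Rightarrow> 'x \<Rightarrow> 'k" where
  "fscale c f = (\<lambda>x. c * f x)"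

global_interpretation fs: vector_space fscale
  by unfold_locales (auto simp: fscale_def fun_eq_iff algebra_simps)

definition basis_vec :: "'x \<Rightarrow> 'x \<Rightarrow> 'k::field" where
  "basis_vec x = (\<lambda>y. if y = x then 1 else 0)"

text \<open>The predicates \<^const>\<open>join_pres\<close> and \<^const>\<open>meet_pres\<close> include that
  both orders are lattices.\<close>

definition lattice_bijection :: "('a, 'c) gorder_scheme \<Rightarrow> ('b, 'd) gorder_scheme \<Rightarrow> ('a \<Rightarrow> 'b) \<Rightarrow> bool" where
  "lattice_bijection L M f \<longleftrightarrow>
     bij_betw f (carrier L) (carrier M) \<and> join_pres L M f \<and> meet_pres L M f"


section \<open>Path algebras and gentle pairs\<close>

text \<open>
  A quiver is a (multi-)digraph.  A path is a pair of its source and its list of arrows, so that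
  \<open>(v, [])\<close> is the trivial path at \<open>v\<close>; paths compose from left to right.
  Elements of the path algebra are the finitely supported coefficient functions on paths; a path is
  identified with its \<^const>\<open>basis_vec\<close>.  The coefficient of a product at a path is a
  sum over the finitely many ways to cut that path into two.
\<close>

definition quiver_paths :: "('v, 'a) pre_digraph \<Rightarrow> ('v \<times> 'a list) set" where
  "quiver_paths Q = {(u, p). \<exists>v. pre_digraph.awalk Q u p v}"

definition path_mult ::
  "('v, 'a) pre_digraph \<Rightarrow> ('v \<times> 'a list \<Rightarrow> 'k::field) \<Rightarrow> ('v \<times> 'a list \<Rightarrow> 'k) \<Rightarrow> 'v \<times> 'a list \<Rightarrow> 'k" where
  "path_mult Q f g = (\<lambda>(u, p). \<Sum>k\<le>length p.
     f (u, take k p) * g (pre_digraph.awlast Q u (take k p), drop k p))"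

definition path_algebra :: "('v, 'a) pre_digraph \<Rightarrow> ('v \<times> 'a list \<Rightarrow> 'k::field) ring" where
  "path_algebra Q = \<lparr>
     carrier = {f. finite {p. f p \<noteq> 0} \<and> {p. f p \<noteq> 0} \<subseteq> quiver_paths Q},
     mult = path_mult Q,
     one = (\<lambda>(u, p). if u \<in> verts Q \<and> p = [] then 1 else 0),
     zero = 0,
     add = (+) \<rparr>"

lemma awlast_append_path: "pre_digraph.awlast Q u (p @ q) = pre_digraph.awlast Q (pre_digraph.awlast Q u p) q"
proof (induction p arbitrary: u)
  case Nil
  then show ?case by (simp add: pre_digraph.awalk_verts.simps)
next
  case (Cons a p)
  have ne: "pre_digraph.awalk_verts Q v xs \<noteq> []" for v and xs :: "'b list"
    by (cases xs) (simp_all add: pre_digraph.awalk_verts.simps)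
  show ?case using Cons by (simp add: pre_digraph.awalk_verts.simps ne)
qed

lemma path_mult_assoc: "path_mult Q (path_mult Q f g) h = path_mult Q f (path_mult Q g h)"
proof (rule ext, clarify)
  fix u p
  let ?n = "length p" and ?e = "\<lambda>k. pre_digraph.awlast Q u (take k p)"
  let ?t = "\<lambda>j i. f (u, take j p) * g (?e j, take i (drop j p)) * h (?e (i + j), drop (i + j) p)"
  have e: "pre_digraph.awlast Q (?e j) (take i (drop j p)) = ?e (i + j)" for i j
    by (metis awlast_append_path add.commute take_add)
  have "path_mult Q (path_mult Q f g) h (u, p) =
      (\<Sum>(k, j)\<in>Sigma {..?n} (\<lambda>k. {..k}). ?t j (k - j))"
    by (auto simp: path_mult_def sum_distrib_right sum.Sigma[symmetric] min_def drop_take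
             intro!: sum.cong)
  also have "\<dots> = (\<Sum>(j, i)\<in>Sigma {..?n} (\<lambda>j. {..?n - j}). ?t j i)"
    by (rule sum.reindex_bij_witness[where i="\<lambda>(j, i). (i + j, j)" and j="\<lambda>(k, j). (j, k - j)"]) auto
  also have "\<dots> = path_mult Q f (path_mult Q g h) (u, p)"
    by (auto simp: path_mult_def sum_distrib_left sum.Sigma[symmetric] e mult.assoc add.commute
             intro!: sum.cong)
  finally show "path_mult Q (path_mult Q f g) h (u, p) = path_mult Q f (path_mult Q g h) (u, p)" .
qed

lemma ring_path_algebra:
  assumes "fin_digraph Q"
  shows "ring (path_algebra Q :: ('v \<times> 'a list \<Rightarrow> 'k::field) ring)"
proof -
  interpret fin_digraph Q by fact
  let ?A = "path_algebra Q :: ('v \<times> 'a list \<Rightarrow> 'k) ring"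
  have mult_closed: "path_mult Q f g \<in> carrier ?A" if "f \<in> carrier ?A" "g \<in> carrier ?A" for f g
  proof -
    have split: "\<exists>k. f (u, take k p) \<noteq> 0 \<and> g (awlast u (take k p), drop k p) \<noteq> 0"
      if "path_mult Q f g (u, p) \<noteq> 0" for u p
      using that unfolding path_mult_def by (auto elim!: sum.not_neutral_contains_not_neutral)
    have "{p. path_mult Q f g p \<noteq> 0} \<subseteq>
        (\<lambda>((u, p), (v, q)). (u, p @ q)) ` ({p. f p \<noteq> 0} \<times> {p. g p \<noteq> 0})"
    proof clarify
      fix u p assume "path_mult Q f g (u, p) \<noteq> 0"
      from split[OF this] obtain k where
        "f (u, take k p) \<noteq> 0" "g (awlast u (take k p), drop k p) \<noteq> 0" by blast
      then show "(u, p) \<in> (\<lambda>((u, p), (v, q)). (u, p @ q)) ` ({p. f p \<noteq> 0} \<times> {p. g p \<noteq> 0})"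
        by (intro image_eqI[where x="((u, take k p), (awlast u (take k p), drop k p))"]) auto
    qed
    then have "finite {p. path_mult Q f g p \<noteq> 0}"
      by (rule finite_subset) (use that in \<open>auto simp: path_algebra_def\<close>)
    moreover have "{p. path_mult Q f g p \<noteq> 0} \<subseteq> quiver_paths Q"
    proof clarify
      fix u p assume "path_mult Q f g (u, p) \<noteq> 0"
      from split[OF this] obtain k where
        "f (u, take k p) \<noteq> 0" "g (awlast u (take k p), drop k p) \<noteq> 0" by blast
      then have "(u, take k p) \<in> quiver_paths Q" "(awlast u (take k p), drop k p) \<in> quiver_paths Q"
        using that by (auto simp: path_algebra_def)
      then obtain v v' where v: "awalk u (take k p) v" and v': "awalk (awlast u (take k p)) (drop k p) v'"
        by (auto simp: quiver_paths_def)
      have "awlast u (take k p) = v"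
        using v unfolding awalk_conv by blast
      then have "awalk u (take k p @ drop k p) v'"
        using v v' by (metis awalk_appendI)
      then have "awalk u p v'"
        by (simp only: append_take_drop_id)
      then show "(u, p) \<in> quiver_paths Q" by (auto simp: quiver_paths_def)
    qed
    ultimately show ?thesis by (simp add: path_algebra_def)
  qed
  have add_closed: "f + g \<in> carrier ?A" if "f \<in> carrier ?A" "g \<in> carrier ?A" for f g
  proof -
    have "{p. (f + g) p \<noteq> 0} \<subseteq> {p. f p \<noteq> 0} \<union> {p. g p \<noteq> 0}" by auto
    with that show ?thesis
      by (auto simp: path_algebra_def intro: finite_subset)
  qed
  have one_closed: "\<one>\<^bsub>?A\<^esub> \<in> carrier ?A"
  proof -
    have "{p. \<one>\<^bsub>?A\<^esub> p \<noteq> 0} = (\<lambda>u. (u, [])) ` verts Q"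
      by (auto simp: path_algebra_def split: if_splits)
    then show ?thesis
      by (auto simp: path_algebra_def quiver_paths_def awalk_Nil_iff)
  qed
  have l_one: "path_mult Q \<one>\<^bsub>?A\<^esub> f = f" if "f \<in> carrier ?A" for f
  proof (rule ext, clarify)
    fix u p
    have "path_mult Q \<one>\<^bsub>?A\<^esub> f (u, p) = (\<Sum>k\<le>length p. if k = 0 then (if u \<in> verts Q then f (u, p) else 0) else 0)"
      unfolding path_mult_def path_algebra_def prod.case
      by (rule sum.cong) auto
    also have "\<dots> = f (u, p)"
      using that by (auto simp: path_algebra_def quiver_paths_def awalk_def)
    finally show "path_mult Q \<one>\<^bsub>?A\<^esub> f (u, p) = f (u, p)" .
  qed
  have r_one: "path_mult Q f \<one>\<^bsub>?A\<^esub> = f" if "f \<in> carrier ?A" for f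
  proof (rule ext, clarify)
    fix u p
    have "path_mult Q f \<one>\<^bsub>?A\<^esub> (u, p) = (\<Sum>k\<le>length p. if k = length p then (if awlast u p \<in> verts Q then f (u, p) else 0) else 0)"
      unfolding path_mult_def path_algebra_def prod.case
      by (rule sum.cong) auto
    also have "\<dots> = f (u, p)"
    proof (cases "f (u, p) = 0")
      case False
      then have "(u, p) \<in> quiver_paths Q"
        using that by (auto simp: path_algebra_def)
      then obtain v where "awalk u p v"
        by (auto simp: quiver_paths_def)
      then have "awlast u p \<in> verts Q"
        unfolding awalk_conv by force
      then show ?thesis by simp
    qed simp
    finally show "path_mult Q f \<one>\<^bsub>?A\<^esub> (u, p) = f (u, p)" .
  qed
  show ?thesis
  proof (rule ringI)
    show "abelian_group ?A"
    proof (rule abelian_groupI)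
      fix f assume "f \<in> carrier ?A"
      then show "\<exists>g\<in>carrier ?A. g \<oplus>\<^bsub>?A\<^esub> f = \<zero>\<^bsub>?A\<^esub>"
        by (intro bexI[of _ "- f"]) (auto simp: path_algebra_def)
    qed (use add_closed in \<open>auto simp: path_algebra_def add_ac\<close>)
    show "Group.monoid ?A"
      by (rule monoidI) (use mult_closed one_closed l_one r_one in \<open>auto simp: path_algebra_def path_mult_assoc\<close>)
  qed (auto simp: path_algebra_def path_mult_def fun_eq_iff algebra_simps sum.distrib)
qed

definition fin_dim_quotient :: "('v, 'a) pre_digraph \<Rightarrow> ('v \<times> 'a list \<Rightarrow> 'k::field) set \<Rightarrow> bool" where
  "fin_dim_quotient Q I \<longleftrightarrow> (\<exists>B. finite B \<and> B \<subseteq> carrier (path_algebra Q) \<and>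
     (\<forall>f \<in> carrier (path_algebra Q). \<exists>g \<in> fs.span B. f - g \<in> I))"

definition path_in :: "('v, 'a) pre_digraph \<Rightarrow> ('v \<times> 'a list \<Rightarrow> 'k::field) set \<Rightarrow> 'a list \<Rightarrow> bool" where
  "path_in Q I p \<longleftrightarrow> p \<noteq> [] \<and> basis_vec (tail Q (hd p), p) \<in> I"

locale gentle_pair = fin_digraph Q
  for Q :: "('v, 'a) pre_digraph" and I :: "('v \<times> 'a list \<Rightarrow> 'k::field) set" +
  assumes fin_dim: "fin_dim_quotient Q I"
    and generated: "\<exists>R \<subseteq> {(tail Q a, [a, b]) | a b. a \<in> arcs Q \<and> b \<in> arcs Q \<and> head Q a = tail Q b}.
      I = Idl\<^bsub>path_algebra Q\<^esub> (basis_vec ` R)"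
    and at_most_two_in: "v \<in> verts Q \<Longrightarrow> in_degree Q v \<le> 2"
    and at_most_two_out: "v \<in> verts Q \<Longrightarrow> out_degree Q v \<le> 2"
    and left_not_in: "b \<in> arcs Q \<Longrightarrow>
      \<exists>\<^sub>\<le>\<^sub>1 a. a \<in> arcs Q \<and> head Q a = tail Q b \<and> \<not> path_in Q I [a, b]"
    and left_in: "b \<in> arcs Q \<Longrightarrow>
      \<exists>\<^sub>\<le>\<^sub>1 a. a \<in> arcs Q \<and> head Q a = tail Q b \<and> path_in Q I [a, b]"
    and right_not_in: "b \<in> arcs Q \<Longrightarrow>
      \<exists>\<^sub>\<le>\<^sub>1 c. c \<in> arcs Q \<and> head Q b = tail Q c \<and> \<not> path_in Q I [b, c]"
    and right_in: "b \<in> arcs Q \<Longrightarrow>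
      \<exists>\<^sub>\<le>\<^sub>1 c. c \<in> arcs Q \<and> head Q b = tail Q c \<and> path_in Q I [b, c]"


section \<open>Strings and bands\<close>

text \<open>The letter \<open>(a, True)\<close> is the arrow \<open>a\<close>, and \<open>(a, False)\<close> is its formal inverse.\<close>

type_synonym 'a letter = "'a \<times> bool"

definition letter_src :: "('v, 'a) pre_digraph \<Rightarrow> 'a letter \<Rightarrow> 'v" where
  "letter_src Q l = (if snd l then tail Q (fst l) else head Q (fst l))"

definition letter_tgt :: "('v, 'a) pre_digraph \<Rightarrow> 'a letter \<Rightarrow> 'v" where
  "letter_tgt Q l = (if snd l then head Q (fst l) else tail Q (fst l))"

definition inv_letter :: "'a letter \<Rightarrow> 'a letter" where
  "inv_letter l = (fst l, \<not> snd l)"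

definition inv_word :: "'a letter list \<Rightarrow> 'a letter list" where
  "inv_word w = rev (map inv_letter w)"

definition is_walk :: "('v, 'a) pre_digraph \<Rightarrow> 'a letter list \<Rightarrow> bool" where
  "is_walk Q w \<longleftrightarrow> fst ` set w \<subseteq> arcs Q \<and>
     successively (\<lambda>l l'. letter_tgt Q l = letter_src Q l' \<and> l' \<noteq> inv_letter l) w"

definition is_relation :: "('v, 'a) pre_digraph \<Rightarrow> ('v \<times> 'a list \<Rightarrow> 'k::field) set \<Rightarrow> 'a letter list \<Rightarrow> bool" where
  "is_relation Q I u \<longleftrightarrow> (\<exists>p. u = map (\<lambda>a. (a, True)) p \<and> path_in Q I p)"

definition is_string :: "('v, 'a) pre_digraph \<Rightarrow> ('v \<times> 'a list \<Rightarrow> 'k::field) set \<Rightarrow> 'a letter list \<Rightarrow> bool" where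
  "is_string Q I w \<longleftrightarrow> is_walk Q w \<and>
     \<not> (\<exists>u. sublist u w \<and> (is_relation Q I u \<or> is_relation Q I (inv_word u)))"

definition word_power :: "'a letter list \<Rightarrow> nat \<Rightarrow> 'a letter list" where
  "word_power w n = concat (replicate n w)"

definition is_band :: "('v, 'a) pre_digraph \<Rightarrow> ('v \<times> 'a list \<Rightarrow> 'k::field) set \<Rightarrow> 'a letter list \<Rightarrow> bool" where
  "is_band Q I w \<longleftrightarrow> w \<noteq> [] \<and> is_walk Q w \<and> (\<forall>n. is_string Q I (word_power w n)) \<and>
     \<not> (\<exists>u n. is_string Q I u \<and> length u < length w \<and> w = word_power u n)"


section \<open>Band modules and canonical submodules\<close>

text \<open>
  A representation of a quiver: a space with an action of the trivial paths (the projections to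
  the spaces at the vertices) and of the arrows.  As paths compose from left to right, this
  determines a right action of the path algebra.
\<close>

record ('v, 'a, 'm) quiver_rep =
  rep_space :: "'m set"
  vertex_act :: "'v \<Rightarrow> 'm \<Rightarrow> 'm"
  arrow_act :: "'a \<Rightarrow> 'm \<Rightarrow> 'm"

definition path_act :: "('v, 'a, 'm) quiver_rep \<Rightarrow> 'v \<times> 'a list \<Rightarrow> 'm \<Rightarrow> 'm" where
  "path_act M = (\<lambda>(u, p) x. fold (arrow_act M) p (vertex_act M u x))"

definition algebra_act ::
  "('v, 'a, 'x \<Rightarrow> 'k::field) quiver_rep \<Rightarrow> ('x \<Rightarrow> 'k) \<Rightarrow> ('v \<times> 'a list \<Rightarrow> 'k) \<Rightarrow> 'x \<Rightarrow> 'k" where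
  "algebra_act M x f = (\<Sum>p | f p \<noteq> 0. fscale (f p) (path_act M p x))"

text \<open>Submodules over the path algebra; on a module annihilated by an ideal \<open>I\<close>, these are the
  submodules over the quotient by \<open>I\<close>.\<close>

definition is_submodule ::
  "('v, 'a) pre_digraph \<Rightarrow> ('v, 'a, 'x \<Rightarrow> 'k::field) quiver_rep \<Rightarrow> ('x \<Rightarrow> 'k) set \<Rightarrow> bool" where
  "is_submodule Q M N \<longleftrightarrow> fs.subspace N \<and> N \<subseteq> rep_space M \<and>
     (\<forall>x \<in> N. \<forall>f \<in> carrier (path_algebra Q). algebra_act M x f \<in> N)"

text \<open>
  Indices start from 0: the \<open>i\<close>-th letter is \<open>w ! i\<close> for \<open>i < length w\<close>, and the canonical
  basis element \<open>z_{i+1}\<close> is \<open>basis_vec i\<close>.  The \<open>k\<close>-th letter joins the basis elements with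
  indices \<open>k\<close> and \<open>next_index w k\<close>, in the direction given by its sign, with the scalar \<open>lam\<close>
  at the last letter.
\<close>

definition next_index :: "'a letter list \<Rightarrow> nat \<Rightarrow> nat" where
  "next_index w k = (if Suc k = length w then 0 else Suc k)"

definition from_index :: "'a letter list \<Rightarrow> nat \<Rightarrow> nat" where
  "from_index w k = (if snd (w ! k) then k else next_index w k)"

definition to_index :: "'a letter list \<Rightarrow> nat \<Rightarrow> nat" where
  "to_index w k = (if snd (w ! k) then next_index w k else k)"

definition canonical_basis :: "'a letter list \<Rightarrow> (nat \<Rightarrow> 'k::field) set" where
  "canonical_basis w = basis_vec ` {..<length w}"

definition band_module ::
  "('v, 'a) pre_digraph \<Rightarrow> 'a letter list \<Rightarrow> 'k::field \<Rightarrow> ('v, 'a, nat \<Rightarrow> 'k) quiver_rep" where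
  "band_module Q w lam = \<lparr>
     rep_space = fs.span (canonical_basis w),
     vertex_act = (\<lambda>v x i. if i < length w \<and> letter_src Q (w ! i) = v then x i else 0),
     arrow_act = (\<lambda>a x. \<Sum>k | k < length w \<and> fst (w ! k) = a.
       fscale ((if Suc k = length w then lam else 1) * x (from_index w k)) (basis_vec (to_index w k))) \<rparr>"

definition canonical_submodules ::
  "('v, 'a) pre_digraph \<Rightarrow> 'a letter list \<Rightarrow> 'k::field \<Rightarrow> (nat \<Rightarrow> 'k) set set" where
  "canonical_submodules Q w lam =
     {N. is_submodule Q (band_module Q w lam) N \<and> (\<exists>S \<subseteq> canonical_basis w. N = fs.span S)}"

definition canonical_submodule_lattice ::
  "('v, 'a) pre_digraph \<Rightarrow> 'a letter list \<Rightarrow> 'k::field \<Rightarrow> (nat \<Rightarrow> 'k) set gorder" where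
  "canonical_submodule_lattice Q w lam =
     \<lparr> carrier = canonical_submodules Q w lam, eq = (=), le = (\<subseteq>) \<rparr>"


section \<open>Snake graphs\<close>

text \<open>
  Snake graphs are drawn in the integer grid with unit square tiles, starting from a tile with
  south-west corner \<open>(0, 0)\<close>.  Tiles are glued to the north or to the east only, so in the grid
  two tiles share nothing except what the gluings prescribe.  A tile is given by its south-west
  corner, an edge by the set of its two end points.
\<close>

type_synonym point = "nat \<times> nat"
type_synonym edge = "point set"

definition corner_SW :: "point \<Rightarrow> point" where "corner_SW p = p"
definition corner_SE :: "point \<Rightarrow> point" where "corner_SE p = (fst p + 1, snd p)"
definition corner_NW :: "point \<Rightarrow> point" where "corner_NW p = (fst p, snd p + 1)"
definition corner_NE :: "point \<Rightarrow> point" where "corner_NE p = (fst p + 1, snd p + 1)"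

definition edge_N :: "point \<Rightarrow> edge" where "edge_N p = {corner_NW p, corner_NE p}"
definition edge_E :: "point \<Rightarrow> edge" where "edge_E p = {corner_SE p, corner_NE p}"
definition edge_S :: "point \<Rightarrow> edge" where "edge_S p = {corner_SW p, corner_SE p}"
definition edge_W :: "point \<Rightarrow> edge" where "edge_W p = {corner_SW p, corner_NW p}"

definition tile_corners :: "point \<Rightarrow> point set" where
  "tile_corners p = {corner_SW p, corner_SE p, corner_NW p, corner_NE p}"

definition tile_edges :: "point \<Rightarrow> edge set" where
  "tile_edges p = {edge_N p, edge_E p, edge_S p, edge_W p}"

text \<open>
  \<open>goes_north u i\<close> says that tile \<open>i + 1\<close> is glued on the north (rather than the east) edge of
  tile \<open>i\<close>.  Three consecutive tiles share a vertex iff the two gluing directions differ, see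
  \<open>common_vertex_iff\<close> below.
\<close>

fun goes_north :: "'a letter list \<Rightarrow> nat \<Rightarrow> bool" where
  "goes_north u 0 = snd (u ! 0)"
| "goes_north u (Suc i) =
     (if snd (u ! i) = snd (u ! Suc i) then \<not> goes_north u i else goes_north u i)"

fun tile :: "'a letter list \<Rightarrow> nat \<Rightarrow> point" where
  "tile u 0 = (0, 0)"
| "tile u (Suc i) = (if goes_north u i then corner_NW (tile u i) else corner_SE (tile u i))"

lemma common_vertex_iff:
  "tile_corners (tile u i) \<inter> tile_corners (tile u (Suc i)) \<inter> tile_corners (tile u (Suc (Suc i))) \<noteq> {}
     \<longleftrightarrow> snd (u ! i) = snd (u ! Suc i)"
  by (cases "tile u i")
     (auto simp: tile_corners_def corner_SW_def corner_SE_def corner_NW_def corner_NE_def)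

definition snake_vertices :: "'a letter list \<Rightarrow> point set" where
  "snake_vertices u = (\<Union>i\<le>length u. tile_corners (tile u i))"

definition snake_edges :: "'a letter list \<Rightarrow> edge set" where
  "snake_edges u = (\<Union>i\<le>length u. tile_edges (tile u i))"

definition perfect_matching :: "'p set \<Rightarrow> 'e set \<Rightarrow> ('p \<Rightarrow> 'e \<Rightarrow> bool) \<Rightarrow> 'e set \<Rightarrow> bool" where
  "perfect_matching V E incident P \<longleftrightarrow> P \<subseteq> E \<and> (\<forall>v \<in> V. \<exists>!e. e \<in> P \<and> incident v e)"

definition snake_matching :: "'a letter list \<Rightarrow> edge set \<Rightarrow> bool" where
  "snake_matching u = perfect_matching (snake_vertices u) (snake_edges u) (\<in>)"

text \<open>The edges bordering exactly one tile of a set \<open>H\<close> of tiles form the boundary of the union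
  of these tiles.\<close>

definition tiles_boundary :: "'a letter list \<Rightarrow> nat set \<Rightarrow> edge set" where
  "tiles_boundary u H = {e. \<exists>!i. i \<in> H \<and> e \<in> tile_edges (tile u i)}"

definition minimal_matching :: "'a letter list \<Rightarrow> edge set" where
  "minimal_matching u = (THE P. snake_matching u P \<and> P \<subseteq> tiles_boundary u {..length u} \<and>
     edge_S (tile u 0) \<in> P)"

definition enclosed_tiles :: "'a letter list \<Rightarrow> edge set \<Rightarrow> nat set" where
  "enclosed_tiles u P = (THE H. H \<subseteq> {..length u} \<and>
     sym_diff P (minimal_matching u) = tiles_boundary u H)"

definition height :: "'a letter list \<Rightarrow> edge set \<Rightarrow> nat \<Rightarrow> nat" where
  "height u P i = (if i \<in> enclosed_tiles u P then 1 else 0)"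


section \<open>Band graphs and good matchings\<close>

text \<open>The snake graph underlying the band graph of \<open>w\<close> is that of \<open>butlast w\<close>; its tiles
  are indexed by \<open>{..<length w}\<close>.\<close>

definition first_tile :: "'a letter list \<Rightarrow> point" where
  "first_tile w = tile (butlast w) 0"

definition last_tile :: "'a letter list \<Rightarrow> point" where
  "last_tile w = tile (butlast w) (length w - 1)"

definition first_cut :: "'a letter list \<Rightarrow> edge" where
  "first_cut w = (if snd (last w) then edge_W (first_tile w) else edge_S (first_tile w))"

definition last_cut :: "'a letter list \<Rightarrow> edge" where
  "last_cut w = (if snd (last w) = even (length w) then edge_E (last_tile w) else edge_N (last_tile w))"

text \<open>
  The end points of the cut edge, glued to each other as is usual for band graphs: the south-west
  corner of the first tile is glued to the end point of \<^term>\<open>last_cut w\<close> that is not the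
  north-east corner of the last tile, and the other end point of \<^term>\<open>first_cut w\<close> is glued
  to that north-east corner.
\<close>

definition cut_point_x :: "'a letter list \<Rightarrow> point set" where
  "cut_point_x w = {corner_SW (first_tile w)} \<union> (last_cut w - {corner_NE (last_tile w)})"

definition cut_point_y :: "'a letter list \<Rightarrow> point set" where
  "cut_point_y w = (first_cut w - {corner_SW (first_tile w)}) \<union> {corner_NE (last_tile w)}"

text \<open>
  The band graph is a quotient of the snake graph, possibly with multiple edges: its vertices and
  edges are the classes of identified vertices and edges.  The two classes of glued vertices are
  disjoint if \<open>w\<close> has at least two letters, which is the case for all bands.
\<close>

definition glue_vertex :: "'a letter list \<Rightarrow> point \<Rightarrow> point set" where
  "glue_vertex w p = (if p \<in> cut_point_x w then cut_point_x w
     else if p \<in> cut_point_y w then cut_point_y w else {p})"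

definition glue_edge :: "'a letter list \<Rightarrow> edge \<Rightarrow> edge set" where
  "glue_edge w e = (if e \<in> {first_cut w, last_cut w} then {first_cut w, last_cut w} else {e})"

definition band_vertices :: "'a letter list \<Rightarrow> point set set" where
  "band_vertices w = glue_vertex w ` snake_vertices (butlast w)"

definition band_edges :: "'a letter list \<Rightarrow> edge set set" where
  "band_edges w = glue_edge w ` snake_edges (butlast w)"

definition band_incident :: "point set \<Rightarrow> edge set \<Rightarrow> bool" where
  "band_incident v e \<longleftrightarrow> v \<inter> \<Union>e \<noteq> {}"

definition cut_edge :: "'a letter list \<Rightarrow> edge set" where
  "cut_edge w = {first_cut w, last_cut w}"

text \<open>The matching edges incident to the end points of the cut edge are on the same side of the
  cut edge iff, before gluing, they all meet the cut edge at the first tile, or they all meet the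
  cut edge at the last tile.\<close>

definition same_side :: "'a letter list \<Rightarrow> edge set set \<Rightarrow> bool" where
  "same_side w P \<longleftrightarrow> (\<exists>c \<in> {first_cut w, last_cut w}. \<forall>e \<in> P.
     band_incident (cut_point_x w) e \<or> band_incident (cut_point_y w) e \<longrightarrow> c \<inter> \<Union>e \<noteq> {})"

definition good_matching :: "'a letter list \<Rightarrow> edge set set \<Rightarrow> bool" where
  "good_matching w P \<longleftrightarrow>
     perfect_matching (band_vertices w) (band_edges w) band_incident P \<and>
     (cut_edge w \<in> P \<or> same_side w P)"

text \<open>The perfect matching of the snake graph obtained by cutting: it consists of the edges of the
  given matching, supplemented (if that does not contain the cut edge) by one copy of the cut edge.\<close>

definition cut_matching :: "'a letter list \<Rightarrow> edge set set \<Rightarrow> edge set" where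
  "cut_matching w P = (THE P'. snake_matching (butlast w) P' \<and>
     (first_cut w \<in> P' \<or> last_cut w \<in> P') \<and>
     P' - {first_cut w, last_cut w} = {e \<in> snake_edges (butlast w). glue_edge w e \<in> P} - {first_cut w, last_cut w} \<and>
     (cut_edge w \<in> P \<longleftrightarrow> first_cut w \<in> P' \<and> last_cut w \<in> P'))"

definition good_matching_lattice :: "'a letter list \<Rightarrow> edge set set gorder" where
  "good_matching_lattice w = \<lparr>
     carrier = {P. good_matching w P},
     eq = (=),
     le = (\<lambda>P1 P2. \<forall>i < length w.
       height (butlast w) (cut_matching w P1) i \<le> height (butlast w) (cut_matching w P2) i) \<rparr>"

end

theory Submission
  imports Defs
begin

text \<open>Both lattices are the lattice \<^term>\<open>cyclic_ideals w\<close> of those sets of indices that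
are closed under the arrows of the band \<open>w\<close>, drawn as a cyclic diagram on its letters;
order, join and meet are inclusion, union and intersection.

For the band module this is nearly the definition: a set of canonical basis vectors spans a
submodule iff each arrow maps the set into itself up to the nonzero scalars \<open>1\<close> and
\<open>lam\<close> (\<open>canonical_submodules_eq\<close>). It matters here that an arrow never
sends one basis vector to a combination of two others, which holds because no letter of a band is
followed by its inverse.

For matchings, sort the vertices of a snake graph by the sum of their coordinates. The first and the
last layer are single vertices, every other layer is the antidiagonal (south-east and north-west
corner) of a unique tile, and edges join consecutive layers only. In a perfect matching the lowest
vertex uses up one vertex of the layer above it, the other vertex of this layer must be matched
upwards, and so on: each antidiagonal has one vertex matched downwards and one matched upwards. A
perfect matching is thus a sequence of choices, one per tile. Between two consecutive antidiagonals
three of the four conceivable edges exist, and the missing one forbids exactly one combination of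
two consecutive choices. Read with alternating sign along the snake, the choice at a tile says
whether the tile is enclosed by the symmetric difference with the minimal matching, and the
forbidden combination is the failure of closedness under one letter of the string. Hence heights
identify perfect matchings with the sets closed under all letters but the last
(\<open>snake_matching_is_ideal_matching\<close>, \<open>enclosed_tiles_ideal_matching\<close>).

The last letter corresponds to the cut edge: the first copy of it lies in the matching of
\<open>H\<close> iff the membership of the first index in \<open>H\<close> has the sign of the last
letter, and the other copy iff the membership of the last index has the opposite sign, so that a
matching contains a copy of the cut edge iff \<open>H\<close> is closed under the last letter too
(\<open>cyclic_ideals_iff\<close>). What remains is that gluing identifies such matchings with the
good matchings of the band graph (\<open>good_matching_glue_matching\<close>,
\<open>good_matching_is_glue_matching\<close>, \<open>cut_matching_glue_matching\<close>). This uses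
that the two copies of the cut edge are disjoint and that no other edge of the snake graph joins two
of their four end points, which fails for words of at most two letters of the same sign. Finite
dimensionality excludes such bands: the powers of a band with letters of a single sign would be
directed paths that are nonzero modulo \<open>I\<close>, read backwards if the letters are inverse
arrows (\<open>band_has_both_signs\<close>).\<close>

section \<open>Lattices represented by sets\<close>

text \<open>A partial order that is isomorphic to a family of sets closed under unions and intersections is a
lattice whose joins and meets are the unions and intersections.\<close>

locale set_represented_lattice =
  fixes L :: "'x gorder" (structure) and h :: "'x \<Rightarrow> 's set" and C :: "'s set set"
  assumes eq_equality: "eq L = (=)"
    and h_bij: "bij_betw h (carrier L) C"
    and le_iff_subset: "x \<in> carrier L \<Longrightarrow> y \<in> carrier L \<Longrightarrow> x \<sqsubseteq> y \<longleftrightarrow> h x \<subseteq> h y"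
    and Un_closed: "A \<in> C \<Longrightarrow> B \<in> C \<Longrightarrow> A \<union> B \<in> C"
    and Int_closed: "A \<in> C \<Longrightarrow> B \<in> C \<Longrightarrow> A \<inter> B \<in> C"
begin

lemma h_mem: "x \<in> carrier L \<Longrightarrow> h x \<in> C"
  using h_bij by (auto simp: bij_betw_def)

lemma h_eq_iff: "x \<in> carrier L \<Longrightarrow> y \<in> carrier L \<Longrightarrow> h x = h y \<longleftrightarrow> x = y"
  using h_bij by (auto simp: bij_betw_def inj_on_def)

lemma h_surj: "A \<in> C \<Longrightarrow> \<exists>x \<in> carrier L. h x = A"
  using h_bij by (auto simp: bij_betw_def)

lemma partial_order_L: "partial_order L"
  by unfold_locales (auto simp: eq_equality le_iff_subset h_eq_iff[symmetric])

lemma least_if_Un: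
  assumes "x \<in> carrier L" "y \<in> carrier L" "z \<in> carrier L" "h z = h x \<union> h y"
  shows "least L z (Upper L {x, y})"
proof -
  have "Upper L {x, y} = {u \<in> carrier L. x \<sqsubseteq> u \<and> y \<sqsubseteq> u}"
    unfolding Upper_def using assms(1,2) by blast
  then show ?thesis using assms by (auto simp add: least_def le_iff_subset)
qed

lemma greatest_if_Int:
  assumes "x \<in> carrier L" "y \<in> carrier L" "z \<in> carrier L" "h z = h x \<inter> h y"
  shows "greatest L z (Lower L {x, y})"
proof -
  have "Lower L {x, y} = {u \<in> carrier L. u \<sqsubseteq> x \<and> u \<sqsubseteq> y}"
    unfolding Lower_def using assms(1,2) by blast
  then show ?thesis using assms by (auto simp add: greatest_def le_iff_subset)
qed

lemma lattice_L: "lattice L"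
proof -
  interpret partial_order L by (rule partial_order_L)
  show ?thesis
  proof unfold_locales
    fix x y assume xy: "x \<in> carrier L" "y \<in> carrier L"
    then show "\<exists>s. least L s (Upper L {x, y})"
      by (meson least_if_Un h_surj Un_closed h_mem)
    from xy show "\<exists>s. greatest L s (Lower L {x, y})"
      by (meson greatest_if_Int h_surj Int_closed h_mem)
  qed
qed

lemma h_join:
  assumes xy: "x \<in> carrier L" "y \<in> carrier L"
  shows "x \<squnion> y \<in> carrier L \<and> h (x \<squnion> y) = h x \<union> h y"
proof -
  interpret lattice L by (rule lattice_L)
  obtain z where z: "z \<in> carrier L" "h z = h x \<union> h y"
    using h_surj Un_closed h_mem xy by meson
  then have "least L z (Upper L {x, y})" using least_if_Un xy by blast
  then have "x \<squnion> y = z"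
    unfolding join_def sup_def by (metis (no_types, lifting) least_unique someI)
  then show ?thesis using z by simp
qed

lemma h_meet:
  assumes xy: "x \<in> carrier L" "y \<in> carrier L"
  shows "x \<sqinter> y \<in> carrier L \<and> h (x \<sqinter> y) = h x \<inter> h y"
proof -
  interpret lattice L by (rule lattice_L)
  obtain z where z: "z \<in> carrier L" "h z = h x \<inter> h y"
    using h_surj Int_closed h_mem xy by meson
  then have "greatest L z (Lower L {x, y})" using greatest_if_Int xy by blast
  then have "x \<sqinter> y = z"
    unfolding meet_def inf_def by (metis (no_types, lifting) greatest_unique someI)
  then show ?thesis using z by simp
qed

end

lemma lattice_bijection_if_same_representation:
  assumes "set_represented_lattice L h C" and "set_represented_lattice M k C"
  shows "\<exists>f. lattice_bijection L M f"
proof -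
  interpret L: set_represented_lattice L h C by fact
  interpret M: set_represented_lattice M k C by fact
  define f where "f = inv_into (carrier M) k \<circ> h"
  have bij: "bij_betw f (carrier L) (carrier M)"
    unfolding f_def by (rule bij_betw_trans[OF L.h_bij bij_betw_inv_into[OF M.h_bij]])
  have f: "f x \<in> carrier M" if "x \<in> carrier L" for x
    using bij that by (rule bij_betw_apply)
  have k_f: "k (f x) = h x" if "x \<in> carrier L" for x
    using L.h_mem[OF that] M.h_bij by (simp add: f_def bij_betw_inv_into_right)
  have "f (x \<squnion>\<^bsub>L\<^esub> y) = f x \<squnion>\<^bsub>M\<^esub> f y" "f (x \<sqinter>\<^bsub>L\<^esub> y) = f x \<sqinter>\<^bsub>M\<^esub> f y"
    if "x \<in> carrier L" "y \<in> carrier L" for x y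
    using that by (auto simp: M.h_eq_iff[symmetric] k_f f L.h_join M.h_join L.h_meet M.h_meet)
  then have "lattice_bijection L M f"
    by (simp add: lattice_bijection_def bij join_pres_def meet_pres_def L.lattice_L M.lattice_L)
  then show ?thesis by blast
qed

section \<open>A band contains an arrow and an inverse arrow\<close>

text \<open>Let \<open>S\<close> be a set of words closed under taking factors. If a product of paths lies in
\<open>S\<close>, so do the factors; hence the elements of the path algebra whose coefficients
vanish on \<open>S\<close> form an ideal.\<close>

definition factor_closed :: "'a list set \<Rightarrow> bool" where
  "factor_closed S \<longleftrightarrow> (\<forall>p \<in> S. \<forall>q. sublist q p \<longrightarrow> q \<in> S)"

lemma factor_closed_take_drop:
  assumes "factor_closed S" "p \<in> S"
  shows "take k p \<in> S" "drop k p \<in> S"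
  using assms sublist_take sublist_drop unfolding factor_closed_def by blast+

lemma ideal_vanishing_on_factor_closed:
  fixes Q :: "('v, 'a) pre_digraph"
  assumes "fin_digraph Q" "factor_closed S"
  shows "ideal {f \<in> carrier (path_algebra Q :: ('v \<times> 'a list \<Rightarrow> 'k::field) ring). \<forall>u. \<forall>p \<in> S. f (u, p) = 0}
    (path_algebra Q)" (is "ideal ?J ?A")
proof -
  interpret ring ?A by (rule ring_path_algebra[OF assms(1)])
  have mult_zero: "path_mult Q f g (u, p) = 0"
    if "p \<in> S" "(\<forall>u. \<forall>p \<in> S. f (u, p) = 0) \<or> (\<forall>u. \<forall>p \<in> S. g (u, p) = 0)" for f g :: "'v \<times> 'a list \<Rightarrow> 'k" and u p
    unfolding path_mult_def prod.case
    using that factor_closed_take_drop[OF assms(2) that(1)] by (intro sum.neutral) auto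
  have mult: "f \<otimes>\<^bsub>?A\<^esub> g \<in> ?J" if "f \<in> carrier ?A" "g \<in> carrier ?A" "f \<in> ?J \<or> g \<in> ?J" for f g
  proof -
    have "f \<otimes>\<^bsub>?A\<^esub> g = path_mult Q f g" by (simp add: path_algebra_def)
    then show ?thesis using that m_closed[of f g] mult_zero[of _ f g] by auto
  qed
  have neg: "\<ominus>\<^bsub>?A\<^esub> f = - f" if "f \<in> carrier ?A" for f
  proof -
    have "- f \<in> carrier ?A" using that by (simp add: path_algebra_def)
    moreover have "- f \<oplus>\<^bsub>?A\<^esub> f = \<zero>\<^bsub>?A\<^esub>" by (simp add: path_algebra_def)
    ultimately show ?thesis using that minus_equality by blast
  qed
  have add: "f \<oplus>\<^bsub>?A\<^esub> g = f + g" and zero: "\<zero>\<^bsub>?A\<^esub> = 0" for f g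
    by (simp_all add: path_algebra_def)
  show ?thesis
  proof (rule idealI)
    show "subgroup ?J (add_monoid ?A)"
    proof (rule add.subgroupI)
      show "?J \<noteq> {}" using zero_closed zero by auto
      show "\<ominus>\<^bsub>?A\<^esub> f \<in> ?J" if "f \<in> ?J" for f
        using that a_inv_closed[of f] neg[of f] by simp
      show "f \<oplus>\<^bsub>?A\<^esub> g \<in> ?J" if "f \<in> ?J" "g \<in> ?J" for f g
        using that a_closed[of f g] add[of f g] by simp
    qed auto
  qed (use mult in \<open>auto intro: ring_axioms\<close>)
qed

text \<open>The elements of \<open>I\<close> vanish on \<open>S\<close>, since the generators of
\<open>I\<close> are paths outside \<open>S\<close>. So a finite set that spans the path algebra
modulo \<open>I\<close> must contain, for each path in \<open>S\<close>, an element in which this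
path occurs, while only finitely many paths occur in such a set.\<close>

lemma finite_factor_closed_avoiding_relations:
  fixes Q :: "('v, 'a) pre_digraph" and I :: "('v \<times> 'a list \<Rightarrow> 'k::field) set"
  assumes "gentle_pair Q I" "factor_closed S"
    and paths: "\<And>p. p \<in> S \<Longrightarrow> p \<noteq> [] \<Longrightarrow> (tail Q (hd p), p) \<in> quiver_paths Q"
    and avoid: "\<And>p. p \<in> S \<Longrightarrow> \<not> path_in Q I p"
  shows "finite S"
proof -
  interpret gentle_pair Q I by fact
  let ?A = "path_algebra Q :: ('v \<times> 'a list \<Rightarrow> 'k) ring"
  let ?J = "{f \<in> carrier ?A. \<forall>u. \<forall>p \<in> S. f (u, p) = 0}"
  interpret ring ?A by (rule ring_path_algebra) (rule fin_digraph_axioms)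
  obtain R where R: "R \<subseteq> {(tail Q a, [a, b]) | a b. a \<in> arcs Q \<and> b \<in> arcs Q \<and> head Q a = tail Q b}"
    and I: "I = Idl\<^bsub>?A\<^esub> (basis_vec ` R)"
    using generated by blast
  have basis_carrier: "basis_vec x \<in> carrier ?A" if "x \<in> quiver_paths Q" for x
    using that by (simp add: path_algebra_def basis_vec_def)
  have R_paths: "R \<subseteq> quiver_paths Q"
  proof
    fix x assume "x \<in> R"
    then obtain a b where x: "x = (tail Q a, [a, b])" "a \<in> arcs Q" "b \<in> arcs Q" "head Q a = tail Q b"
      using R by blast
    then have "awalk (tail Q a) [a, b] (head Q b)"
      by (simp add: awalk_def)
    then show "x \<in> quiver_paths Q" using x(1) by (auto simp: quiver_paths_def)
  qed
  then have "basis_vec ` R \<subseteq> I"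
    unfolding I using basis_carrier by (intro genideal_self) blast
  have "basis_vec ` R \<subseteq> ?J"
  proof
    fix f :: "'v \<times> 'a list \<Rightarrow> 'k" assume "f \<in> basis_vec ` R"
    then obtain x where x: "x \<in> R" "f = basis_vec x" by blast
    then obtain a b where ab: "x = (tail Q a, [a, b])" using R by blast
    have "path_in Q I [a, b]"
      using \<open>basis_vec ` R \<subseteq> I\<close> x ab by (auto simp: path_in_def)
    then have "[a, b] \<notin> S" using avoid by blast
    then show "f \<in> ?J"
      using x ab basis_carrier R_paths by (auto simp: basis_vec_def)
  qed
  then have I_J: "I \<subseteq> ?J"
    unfolding I by (intro genideal_minimal ideal_vanishing_on_factor_closed fin_digraph_axioms assms(2))
  obtain B :: "('v \<times> 'a list \<Rightarrow> 'k) set" where B: "finite B" "B \<subseteq> carrier ?A"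
    and span: "\<And>f. f \<in> carrier ?A \<Longrightarrow> \<exists>g \<in> fs.span B. f - g \<in> I"
    using fin_dim unfolding fin_dim_quotient_def by blast
  let ?F = "\<Union>b\<in>B. {p. b p \<noteq> 0}"
  have "finite ?F"
    using B by (auto simp: path_algebra_def)
  moreover have "S - {[]} \<subseteq> snd ` ?F"
  proof
    fix p assume p: "p \<in> S - {[]}"
    let ?x = "(tail Q (hd p), p)"
    obtain g where g: "g \<in> fs.span B" "basis_vec ?x - g \<in> I"
      using span basis_carrier paths p by blast
    then have "basis_vec ?x - g \<in> ?J" using I_J by blast
    then have "(basis_vec ?x - g) ?x = 0" using p by blast
    then have "g ?x = 1" by (simp add: basis_vec_def)
    \<comment> \<open>Vanishing at the path is a linear condition, so it would pass to the span.\<close>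
    have "\<exists>b \<in> B. b ?x \<noteq> 0"
    proof (rule ccontr)
      assume "\<not> (\<exists>b \<in> B. b ?x \<noteq> 0)"
      then have "B \<subseteq> {f. f ?x = 0}" by blast
      moreover have "fs.subspace {f :: 'v \<times> 'a list \<Rightarrow> 'k. f ?x = 0}"
        by (simp add: fs.subspace_def fscale_def)
      ultimately have "fs.span B \<subseteq> {f. f ?x = 0}" by (rule fs.span_minimal)
      with g(1) \<open>g ?x = 1\<close> show False by auto
    qed
    then show "p \<in> snd ` ?F" by force
  qed
  ultimately have "finite (S - {[]})" by (meson finite_surj)
  then show ?thesis by simp
qed

lemma length_word_power: "length (word_power w n) = n * length w"
  by (induction n) (simp_all add: word_power_def)

lemma set_word_power: "set (word_power w n) \<subseteq> set w"
  by (auto simp: word_power_def)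

lemma cas_of_successively:
  assumes "successively (\<lambda>a b. head Q a = tail Q b) p" "p \<noteq> []"
  shows "pre_digraph.cas Q (tail Q (hd p)) p (head Q (last p))"
  using assms
proof (induction p)
  case (Cons a p)
  then show ?case by (cases p) (auto simp: pre_digraph.cas.simps)
qed simp

lemma quiver_path_of_successively:
  assumes "wf_digraph Q" "set p \<subseteq> arcs Q" "successively (\<lambda>a b. head Q a = tail Q b) p" "p \<noteq> []"
  shows "(tail Q (hd p), p) \<in> quiver_paths Q"
proof -
  interpret wf_digraph Q by fact
  have "hd p \<in> arcs Q" using assms(2,4) by auto
  then show ?thesis
    using assms cas_of_successively[OF assms(3,4)] by (auto simp: quiver_paths_def awalk_def)
qed

text \<open>The paths that occur in the words of \<open>W\<close>, along the arrows for \<open>s = True\<close>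
and, as inverses, against the arrows for \<open>s = False\<close>; in the latter case the word shows
the path from its end to its start.\<close>

definition directed_paths :: "bool \<Rightarrow> 'a letter list set \<Rightarrow> 'a list set" where
  "directed_paths s W = {p. \<exists>w \<in> W. sublist (map (\<lambda>a. (a, s)) (if s then p else rev p)) w}"

lemma factor_closed_directed_paths: "factor_closed (directed_paths s W)"
  unfolding factor_closed_def
proof (intro ballI allI impI)
  fix p q assume p: "p \<in> directed_paths s W" and q: "sublist q p"
  then obtain w where w: "w \<in> W" "sublist (map (\<lambda>a. (a, s)) (if s then p else rev p)) w"
    by (auto simp: directed_paths_def)
  have "sublist (map (\<lambda>a. (a, s)) (if s then q else rev q)) (map (\<lambda>a. (a, s)) (if s then p else rev p))"
    using q by (auto intro: map_mono_sublist)
  then show "q \<in> directed_paths s W"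
    using w sublist_order.order.trans unfolding directed_paths_def by blast
qed

lemma gentle_pair_finite_directed_paths:
  fixes Q :: "('v, 'a) pre_digraph" and I :: "('v \<times> 'a list \<Rightarrow> 'k::field) set"
  assumes "gentle_pair Q I" and strings: "\<And>w. w \<in> W \<Longrightarrow> is_string Q I w"
  shows "finite (directed_paths s W)"
proof (rule finite_factor_closed_avoiding_relations[OF assms(1) factor_closed_directed_paths])
  interpret gentle_pair Q I by fact
  fix p assume "p \<in> directed_paths s W"
  then obtain w where w: "is_string Q I w" "sublist (map (\<lambda>a. (a, s)) (if s then p else rev p)) w"
    using strings by (auto simp: directed_paths_def)
  show "\<not> path_in Q I p"
  proof
    assume "path_in Q I p"
    then have "is_relation Q I (map (\<lambda>a. (a, True)) p)" by (auto simp: is_relation_def)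
    moreover have "inv_word (map (\<lambda>a. (a, False)) (rev p)) = map (\<lambda>a. (a, True)) p"
      by (simp add: inv_word_def inv_letter_def rev_map)
    ultimately show False
      using w unfolding is_string_def by (cases s) auto
  qed
  assume "p \<noteq> []"
  from w have walk: "is_walk Q w" by (simp add: is_string_def)
  have "successively (\<lambda>l l'. letter_tgt Q l = letter_src Q l') w"
    using walk unfolding is_walk_def by (auto elim: successively_mono)
  with w(2) have succ: "successively (\<lambda>l l'. letter_tgt Q l = letter_src Q l') (map (\<lambda>a. (a, s)) (if s then p else rev p))"
    by (auto simp: sublist_def successively_append_iff)
  have "successively (\<lambda>a b. head Q a = tail Q b) p"
  proof (cases s)
    case True
    with succ show ?thesis by (simp add: successively_map letter_tgt_def letter_src_def)
  next
    case False
    with succ have "successively (\<lambda>a b. tail Q b = head Q a) p"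
      by (simp add: successively_map letter_tgt_def letter_src_def)
    then show ?thesis by (rule successively_mono) simp
  qed
  moreover have "set p \<subseteq> arcs Q"
  proof -
    have "set (map (\<lambda>a. (a, s)) (if s then p else rev p)) \<subseteq> set w"
      using w(2) by (rule set_mono_sublist)
    then have "(\<lambda>a. (a, s)) ` set p \<subseteq> set w" by (auto split: if_splits)
    with walk show ?thesis unfolding is_walk_def by force
  qed
  ultimately show "(tail Q (hd p), p) \<in> quiver_paths Q"
    using \<open>p \<noteq> []\<close> by (intro quiver_path_of_successively wf_digraph_axioms)
qed

text \<open>Otherwise the powers of \<open>w\<close> would be directed paths of unbounded length without relations.\<close>

lemma band_has_both_signs:
  assumes "gentle_pair Q I" and band: "is_band Q I w"
  shows "\<exists>l \<in> set w. snd l = s"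
proof (rule ccontr)
  assume no: "\<not> (\<exists>l \<in> set w. snd l = s)"
  let ?W = "range (word_power w)" and ?p = "\<lambda>n. map fst (word_power w n)"
  let ?q = "\<lambda>n. if \<not> s then ?p n else rev (?p n)"
  have "finite (directed_paths (\<not> s) ?W)"
    using band by (intro gentle_pair_finite_directed_paths[OF assms(1)]) (auto simp: is_band_def)
  moreover have "?q n \<in> directed_paths (\<not> s) ?W" for n
  proof -
    have "(fst l, \<not> s) = l" if "l \<in> set (word_power w n)" for l
    proof -
      have "snd l \<noteq> s" using that no set_word_power by blast
      then show ?thesis by (cases l) simp
    qed
    then have "map (\<lambda>a. (a, \<not> s)) (?p n) = word_power w n"
      by (simp add: map_idI)
    then have "sublist (map (\<lambda>a. (a, \<not> s)) (if \<not> s then ?q n else rev (?q n))) (word_power w n)"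
      by (cases s) (simp_all only: if_True if_False not_True_eq_False not_False_eq_True rev_rev_ident sublist_order.order.refl)
    then show ?thesis unfolding directed_paths_def by (intro CollectI bexI[OF _ rangeI])
  qed
  moreover have "inj ?q"
  proof (rule injI)
    fix m n assume "?q m = ?q n"
    then have "length (?q m) = length (?q n)" by simp
    then have "m * length w = n * length w" by (simp add: length_word_power split: if_splits)
    then show "m = n" using band by (simp add: is_band_def)
  qed
  ultimately show False
    using finite_subset[of "range ?q"] finite_imageD[of ?q UNIV] by blast
qed

section \<open>Canonical submodules\<close>

text \<open>The order ideals of the preorder on the indices that is generated by the arrows of the band module.\<close>

definition cyclic_ideals :: "'a letter list \<Rightarrow> nat set set" where
  "cyclic_ideals w = {H. H \<subseteq> {..<length w} \<and>
     (\<forall>k < length w. from_index w k \<in> H \<longrightarrow> to_index w k \<in> H)}"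

lemma cyclic_ideals_Un: "A \<in> cyclic_ideals w \<Longrightarrow> B \<in> cyclic_ideals w \<Longrightarrow> A \<union> B \<in> cyclic_ideals w"
  and cyclic_ideals_Int: "A \<in> cyclic_ideals w \<Longrightarrow> B \<in> cyclic_ideals w \<Longrightarrow> A \<inter> B \<in> cyclic_ideals w"
  by (auto simp: cyclic_ideals_def)

definition coordinate_span :: "nat set \<Rightarrow> (nat \<Rightarrow> 'k::field) set" where
  "coordinate_span H = fs.span (basis_vec ` H)"

lemma mem_coordinate_span_iff:
  fixes x :: "nat \<Rightarrow> 'k::field"
  assumes "finite H"
  shows "x \<in> coordinate_span H \<longleftrightarrow> (\<forall>i. i \<notin> H \<longrightarrow> x i = 0)"
proof
  have "coordinate_span H \<subseteq> {x :: nat \<Rightarrow> 'k. \<forall>i. i \<notin> H \<longrightarrow> x i = 0}"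
    unfolding coordinate_span_def
    by (rule fs.span_minimal) (auto simp: basis_vec_def fs.subspace_def fscale_def)
  then show "x \<in> coordinate_span H \<Longrightarrow> \<forall>i. i \<notin> H \<longrightarrow> x i = 0" by blast
next
  assume x: "\<forall>i. i \<notin> H \<longrightarrow> x i = 0"
  have sum_apply: "(\<Sum>i\<in>A. f i) j = (\<Sum>i\<in>A. f i j)" for A :: "nat set" and f :: "nat \<Rightarrow> nat \<Rightarrow> 'k" and j
    by (induction A rule: infinite_finite_induct) auto
  have "x = (\<Sum>i\<in>H. fscale (x i) (basis_vec i))"
    using x by (intro ext) (simp add: sum_apply fscale_def basis_vec_def assms if_distrib[of "\<lambda>c. _ * c"] cong: if_cong)
  also have "\<dots> \<in> coordinate_span H"
    unfolding coordinate_span_def by (intro fs.span_sum fs.span_scale fs.span_base) simp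
  finally show "x \<in> coordinate_span H" .
qed

lemma basis_vec_mem_coordinate_span:
  assumes "finite H"
  shows "(basis_vec i :: nat \<Rightarrow> 'k::field) \<in> coordinate_span H \<longleftrightarrow> i \<in> H"
  unfolding mem_coordinate_span_iff[OF assms] by (auto simp: basis_vec_def)

text \<open>As the square of a band is a string, the conditions on consecutive letters also apply to the last
letter followed by the first one.\<close>

lemma band_cyclic_walk:
  assumes "is_band Q I w" "k < length w"
  shows "letter_tgt Q (w ! k) = letter_src Q (w ! next_index w k)"
    and "w ! next_index w k \<noteq> inv_letter (w ! k)"
proof -
  have "is_walk Q (word_power w 2)"
    using assms by (auto simp: is_band_def is_string_def)
  then have "is_walk Q (w @ w)"
    by (simp add: word_power_def numeral_2_eq_2)
  then have succ: "successively (\<lambda>l l'. letter_tgt Q l = letter_src Q l' \<and> l' \<noteq> inv_letter l) (w @ w)"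
    by (simp add: is_walk_def)
  have "Suc k < length (w @ w)" using assms(2) by simp
  with succ have "letter_tgt Q ((w @ w) ! k) = letter_src Q ((w @ w) ! Suc k) \<and> (w @ w) ! Suc k \<noteq> inv_letter ((w @ w) ! k)"
    unfolding successively_conv_nth by blast
  moreover have "(w @ w) ! Suc k = w ! next_index w k" "(w @ w) ! k = w ! k"
    using assms(2) by (auto simp: nth_append next_index_def not_less less_Suc_eq_le le_antisym)
  ultimately show "letter_tgt Q (w ! k) = letter_src Q (w ! next_index w k)"
    "w ! next_index w k \<noteq> inv_letter (w ! k)" by simp_all
qed

lemma next_index_less: "k < length w \<Longrightarrow> next_index w k < length w"
  by (auto simp: next_index_def)

lemma from_index_less: "k < length w \<Longrightarrow> from_index w k < length w"
  by (simp add: from_index_def next_index_less)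

text \<open>Two occurrences of an arrow that act on the same basis vector have opposite signs unless they are
equal, and then they are a letter followed by its inverse.\<close>

lemma from_index_inj:
  assumes band: "is_band Q I w" and "k < length w" "l < length w"
    and "fst (w ! k) = fst (w ! l)" "from_index w k = from_index w l"
  shows "k = l"
proof -
  have neq: False if "j < length w" "i = next_index w j" "fst (w ! i) = fst (w ! j)" "snd (w ! i)" "\<not> snd (w ! j)" for i j
    using band_cyclic_walk(2)[OF band that(1)] that by (simp add: inv_letter_def prod_eq_iff)
  show ?thesis
  proof (cases "snd (w ! k) = snd (w ! l)")
    case True
    then show ?thesis using assms(5) by (auto simp: from_index_def next_index_def split: if_splits)
  next
    case False
    then show ?thesis using assms(2-5) neq[of k l] neq[of l k] by (auto simp: from_index_def split: if_splits)
  qed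
qed

lemma letter_src_from_index:
  assumes "is_band Q I w" "k < length w"
  shows "letter_src Q (w ! from_index w k) = tail Q (fst (w ! k))"
  using band_cyclic_walk(1)[OF assms]
  by (cases "snd (w ! k)") (auto simp: from_index_def letter_src_def letter_tgt_def)

lemma arrow_act_basis_vec:
  assumes band: "is_band Q I w" and k: "k < length w"
  shows "arrow_act (band_module Q w lam) (fst (w ! k)) (basis_vec (from_index w k)) =
    fscale (if Suc k = length w then lam else 1) (basis_vec (to_index w k))"
proof -
  let ?K = "{l. l < length w \<and> fst (w ! l) = fst (w ! k)}"
  have "arrow_act (band_module Q w lam) (fst (w ! k)) (basis_vec (from_index w k)) =
      (\<Sum>l\<in>?K. if l = k then fscale (if Suc k = length w then lam else 1) (basis_vec (to_index w k)) else 0)"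
    unfolding band_module_def quiver_rep.simps
  proof (rule sum.cong[OF refl])
    fix l assume "l \<in> ?K"
    then have "from_index w l = from_index w k \<longleftrightarrow> l = k"
      using from_index_inj[OF band, of l k] k by auto
    then show "fscale ((if Suc l = length w then lam else 1) * basis_vec (from_index w k) (from_index w l)) (basis_vec (to_index w l)) =
        (if l = k then fscale (if Suc k = length w then lam else 1) (basis_vec (to_index w k)) else 0)"
      by (auto simp: basis_vec_def fscale_def)
  qed
  also have "\<dots> = fscale (if Suc k = length w then lam else 1) (basis_vec (to_index w k))"
    using k by (simp add: sum.delta')
  finally show ?thesis .
qed

lemma algebra_act_basis_vec: "algebra_act M x (basis_vec p) = path_act M p x"
proof -
  have "{q. (basis_vec p q :: 'k::field) \<noteq> 0} = {p}" by (auto simp: basis_vec_def)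
  then show ?thesis unfolding algebra_act_def by (simp add: basis_vec_def fscale_def)
qed

text \<open>By \<open>arrow_act_basis_vec\<close>, each letter gives an arrow that maps one canonical basis
vector to a nonzero multiple of another one, so that a submodule containing the former contains the
latter.\<close>

lemma is_submodule_coordinate_span_iff:
  fixes Q :: "('v, 'a) pre_digraph" and lam :: "'k::field"
  assumes "wf_digraph Q" and band: "is_band Q I w" and lam: "lam \<noteq> 0" and H: "H \<subseteq> {..<length w}"
  shows "is_submodule Q (band_module Q w lam) (coordinate_span H) \<longleftrightarrow> H \<in> cyclic_ideals w"
proof
  interpret wf_digraph Q by fact
  let ?M = "band_module Q w lam"
  have fin: "finite H" using H finite_subset by blast
  note mem = mem_coordinate_span_iff[OF fin]
  {
    assume sub: "is_submodule Q ?M (coordinate_span H)"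
    have "to_index w k \<in> H" if k: "k < length w" "from_index w k \<in> H" for k
    proof -
      let ?a = "fst (w ! k)" and ?i = "from_index w k"
      have "w ! k \<in> set w" using k(1) by simp
      then have "?a \<in> arcs Q"
        using band unfolding is_band_def is_walk_def by (metis image_subset_iff)
      then have "awalk (tail Q ?a) [?a] (head Q ?a)" by (rule arc_implies_awalk)
      then have "(basis_vec (tail Q ?a, [?a]) :: _ \<Rightarrow> 'k) \<in> carrier (path_algebra Q)"
        by (auto simp: path_algebra_def basis_vec_def quiver_paths_def)
      moreover have "(basis_vec ?i :: _ \<Rightarrow> 'k) \<in> coordinate_span H"
        using k(2) basis_vec_mem_coordinate_span[OF fin] by blast
      ultimately have "path_act ?M (tail Q ?a, [?a]) (basis_vec ?i) \<in> coordinate_span H"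
        using sub unfolding is_submodule_def by (metis algebra_act_basis_vec)
      moreover have "vertex_act ?M (tail Q ?a) (basis_vec ?i) = basis_vec ?i"
        using letter_src_from_index[OF band k(1)] from_index_less[OF k(1)]
        by (auto simp: band_module_def basis_vec_def)
      then have "path_act ?M (tail Q ?a, [?a]) (basis_vec ?i) =
          fscale (if Suc k = length w then lam else 1) (basis_vec (to_index w k))"
        by (simp add: path_act_def arrow_act_basis_vec[OF band k(1)])
      ultimately show ?thesis
        using lam unfolding mem by (auto simp: fscale_def basis_vec_def split: if_splits)
    qed
    then show "H \<in> cyclic_ideals w" using H by (simp add: cyclic_ideals_def)
  }
  {
    assume ideal: "H \<in> cyclic_ideals w"
    have space: "fs.subspace (coordinate_span H :: (nat \<Rightarrow> 'k) set)"
      by (simp add: coordinate_span_def)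
    have vertex: "vertex_act ?M v x \<in> coordinate_span H" if "x \<in> coordinate_span H" for v x
      using that unfolding mem by (simp add: band_module_def)
    have arrow: "arrow_act ?M a x \<in> coordinate_span H" if x: "x \<in> coordinate_span H" for a x
      unfolding band_module_def quiver_rep.simps
    proof (intro fs.subspace_sum[OF space])
      fix k assume k: "k \<in> {k. k < length w \<and> fst (w ! k) = a}"
      show "fscale ((if Suc k = length w then lam else 1) * x (from_index w k)) (basis_vec (to_index w k)) \<in> coordinate_span H"
      proof (cases "from_index w k \<in> H")
        case True
        then have "to_index w k \<in> H" using ideal k by (simp add: cyclic_ideals_def)
        then show ?thesis
          using fs.subspace_scale[OF space] basis_vec_mem_coordinate_span[OF fin] by blast
      next
        case False
        then have "x (from_index w k) = 0" using x mem by blast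
        then show ?thesis unfolding mem by (simp add: fscale_def)
      qed
    qed
    have "fold (arrow_act ?M) p x \<in> coordinate_span H" if "x \<in> coordinate_span H" for p x
      using that by (induction p arbitrary: x) (simp_all add: arrow)
    then have path: "path_act ?M q x \<in> coordinate_span H" if "x \<in> coordinate_span H" for q x
      using that vertex by (cases q) (simp add: path_act_def)
    have "algebra_act ?M x f \<in> coordinate_span H" if "x \<in> coordinate_span H" for x f
      unfolding algebra_act_def
      using that by (intro fs.subspace_sum[OF space] fs.subspace_scale[OF space] path)
    moreover have "coordinate_span H \<subseteq> rep_space ?M"
      unfolding coordinate_span_def band_module_def canonical_basis_def quiver_rep.simps
      by (rule fs.span_mono[OF image_mono[OF H]])
    ultimately show "is_submodule Q ?M (coordinate_span H)"
      using space unfolding is_submodule_def by blast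
  }
qed

lemma canonical_submodules_eq:
  fixes Q :: "('v, 'a) pre_digraph" and lam :: "'k::field"
  assumes "wf_digraph Q" "is_band Q I w" "lam \<noteq> 0"
  shows "canonical_submodules Q w lam = coordinate_span ` cyclic_ideals w"
proof -
  have "canonical_submodules Q w lam =
      {coordinate_span H | H. H \<subseteq> {..<length w} \<and> is_submodule Q (band_module Q w lam) (coordinate_span H)}"
    unfolding canonical_submodules_def canonical_basis_def coordinate_span_def subset_image_iff by blast
  also have "\<dots> = coordinate_span ` cyclic_ideals w"
    using is_submodule_coordinate_span_iff[OF assms] by (auto simp: cyclic_ideals_def)
  finally show ?thesis .
qed

lemma canonical_submodule_lattice_represented:
  fixes Q :: "('v, 'a) pre_digraph" and lam :: "'k::field"
  assumes "wf_digraph Q" "is_band Q I w" "lam \<noteq> 0"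
  shows "set_represented_lattice (canonical_submodule_lattice Q w lam) (\<lambda>N. {i. basis_vec i \<in> N}) (cyclic_ideals w)"
proof -
  let ?L = "canonical_submodule_lattice Q w lam" and ?h = "\<lambda>N :: (nat \<Rightarrow> 'k) set. {i. basis_vec i \<in> N}"
  have carrier: "carrier ?L = coordinate_span ` cyclic_ideals w"
    using canonical_submodules_eq[OF assms] by (simp add: canonical_submodule_lattice_def)
  have fin: "finite H" if "H \<in> cyclic_ideals w" for H
    using that finite_subset unfolding cyclic_ideals_def by blast
  then have h: "?h (coordinate_span H) = H" if "H \<in> cyclic_ideals w" for H
    using that by (simp add: basis_vec_mem_coordinate_span)
  have mono: "(coordinate_span H :: (nat \<Rightarrow> 'k) set) \<subseteq> coordinate_span H'" if "H \<subseteq> H'" for H H'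
    unfolding coordinate_span_def using that by (intro fs.span_mono image_mono)
  show ?thesis
  proof
    show "bij_betw ?h (carrier ?L) (cyclic_ideals w)"
      using h by (intro bij_betw_byWitness[where f' = coordinate_span]) (auto simp: carrier)
    show "le ?L N N' \<longleftrightarrow> ?h N \<subseteq> ?h N'" if NN: "N \<in> carrier ?L" "N' \<in> carrier ?L" for N N'
    proof -
      from NN obtain H H' where "N = coordinate_span H" "H \<in> cyclic_ideals w"
        "N' = coordinate_span H'" "H' \<in> cyclic_ideals w"
        unfolding carrier by blast
      then have "?h N \<subseteq> ?h N' \<Longrightarrow> N \<subseteq> N'"
        using h[of H] h[of H'] mono[of H H'] by simp
      then have "?h N \<subseteq> ?h N' \<longleftrightarrow> N \<subseteq> N'" by blast
      then show ?thesis by (simp add: canonical_submodule_lattice_def)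
    qed
  qed (simp_all add: canonical_submodule_lattice_def cyclic_ideals_Un cyclic_ideals_Int)
qed

section \<open>The snake graph as a layered graph\<close>

text \<open>The layers of the snake graph: a point is on the layer given by the sum of its coordinates. As tiles
are glued to the north or to the east, the south-west corner of the \<open>i\<close>-th tile is on
layer \<open>i\<close>, so that its two other antidiagonal corners are on layer \<open>i +
1\<close>.\<close>

definition level :: "point \<Rightarrow> nat" where
  "level p = fst p + snd p"

definition diag_corner :: "'a letter list \<Rightarrow> nat \<Rightarrow> bool \<Rightarrow> point" where
  "diag_corner u i b = (if b then corner_NW (tile u i) else corner_SE (tile u i))"

definition top_corner :: "'a letter list \<Rightarrow> point" where
  "top_corner u = corner_NE (tile u (length u))"

lemmas corner_defs = corner_SW_def corner_SE_def corner_NW_def corner_NE_def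

text \<open>The gluing direction turns with every repetition of a sign and is kept with every change of
sign, hence it depends only on the sign and on the parity of the index.\<close>

lemma goes_north_iff: "goes_north u i \<longleftrightarrow> (snd (u ! i) \<longleftrightarrow> even i)"
  by (induction i) auto

lemma level_tile: "level (tile u i) = i"
  by (induction i) (auto simp: level_def corner_defs)

lemma level_diag_corner [simp]: "level (diag_corner u i b) = Suc i"
  using level_tile[of u i] by (simp add: level_def diag_corner_def corner_defs)

lemma level_top_corner [simp]: "level (top_corner u) = length u + 2"
  using level_tile[of u "length u"] by (simp add: level_def top_corner_def corner_defs)

lemma level_origin [simp]: "level (0, 0) = 0"
  by (simp add: level_def)

lemma diag_corner_eq_iff [simp]: "diag_corner u i a = diag_corner u j b \<longleftrightarrow> i = j \<and> a = b"
proof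
  assume eq: "diag_corner u i a = diag_corner u j b"
  then have "i = j" by (auto dest: arg_cong[of _ _ level])
  with eq show "i = j \<and> a = b" by (auto simp: diag_corner_def corner_defs split: if_splits)
qed simp

lemma origin_neq_diag_corner [simp]:
  "(0, 0) \<noteq> diag_corner u i b" "diag_corner u i b \<noteq> (0, 0)"
  by (auto dest: arg_cong[of _ _ level])

lemma origin_neq_top_corner [simp]:
  "(0, 0) \<noteq> top_corner u" "top_corner u \<noteq> (0, 0)"
  by (auto dest: arg_cong[of _ _ level])

lemma diag_corner_neq_top_corner [simp]:
  assumes "i \<le> length u"
  shows "diag_corner u i b \<noteq> top_corner u" "top_corner u \<noteq> diag_corner u i b"
  using assms by (auto dest: arg_cong[of _ _ level])

text \<open>The south-west and the north-east corner of a tile lie on the antidiagonals of the previous and of the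
next tile, with the side determined by the gluing direction.  All edges can therefore be described
by the antidiagonals alone.\<close>

lemma corner_SW_tile_0: "corner_SW (tile u 0) = (0, 0)"
  by (simp add: corner_defs)

lemma corner_SW_tile_Suc: "corner_SW (tile u (Suc i)) = diag_corner u i (goes_north u i)"
  by (simp add: diag_corner_def corner_defs)

lemma corner_NE_tile: "corner_NE (tile u i) = diag_corner u (Suc i) (\<not> goes_north u i)"
  by (simp add: diag_corner_def corner_defs)

lemma corner_NW_tile: "corner_NW (tile u i) = diag_corner u i True"
  and corner_SE_tile: "corner_SE (tile u i) = diag_corner u i False"
  by (simp_all add: diag_corner_def)

lemma edge_S_tile_0: "edge_S (tile u 0) = {(0, 0), diag_corner u 0 False}"
  and edge_W_tile_0: "edge_W (tile u 0) = {(0, 0), diag_corner u 0 True}"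
  by (simp_all only: edge_S_def edge_W_def corner_SW_tile_0 corner_NW_tile corner_SE_tile)

lemma edge_S_tile_Suc: "edge_S (tile u (Suc i)) = {diag_corner u i (goes_north u i), diag_corner u (Suc i) False}"
  and edge_W_tile_Suc: "edge_W (tile u (Suc i)) = {diag_corner u i (goes_north u i), diag_corner u (Suc i) True}"
  by (simp_all only: edge_S_def edge_W_def corner_SW_tile_Suc corner_NW_tile corner_SE_tile)

lemma edge_N_tile: "edge_N (tile u i) = {diag_corner u i True, diag_corner u (Suc i) (\<not> goes_north u i)}"
  and edge_E_tile: "edge_E (tile u i) = {diag_corner u i False, diag_corner u (Suc i) (\<not> goes_north u i)}"
  by (simp_all only: edge_N_def edge_E_def corner_NE_tile corner_NW_tile corner_SE_tile)

lemma edge_N_last_tile: "edge_N (tile u (length u)) = {diag_corner u (length u) True, top_corner u}"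
  and edge_E_last_tile: "edge_E (tile u (length u)) = {diag_corner u (length u) False, top_corner u}"
  by (simp_all only: edge_N_def edge_E_def top_corner_def corner_NW_tile corner_SE_tile)

lemma diag_corner_mem_tile_corners: "diag_corner u i b \<in> tile_corners (tile u i)"
  by (simp add: diag_corner_def tile_corners_def)

lemma snake_vertices_layered:
  "snake_vertices u = {(0, 0), top_corner u} \<union> {diag_corner u i b | i b. i \<le> length u}" (is "_ = ?V")
proof (rule equalityI)
  have diag: "diag_corner u i b \<in> ?V" if "i \<le> length u" for i b
    using that by auto
  have "corner_SW (tile u i) \<in> ?V" if "i \<le> length u" for i
  proof (cases i)
    case 0
    show ?thesis unfolding 0 corner_SW_tile_0 by simp
  next
    case (Suc j)
    with that show ?thesis unfolding Suc corner_SW_tile_Suc by (intro diag) simp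
  qed
  moreover have "corner_NE (tile u i) \<in> ?V" if "i \<le> length u" for i
  proof (cases "i = length u")
    case False
    with that show ?thesis unfolding corner_NE_tile by (intro diag) simp
  qed (simp add: top_corner_def)
  ultimately have "tile_corners (tile u i) \<subseteq> ?V" if "i \<le> length u" for i
    unfolding tile_corners_def corner_NW_tile corner_SE_tile insert_subset
    using that by (simp only: diag simp_thms empty_subsetI)
  then show "snake_vertices u \<subseteq> ?V"
    unfolding snake_vertices_def by (intro UN_least) simp
  have "(0, 0) \<in> tile_corners (tile u 0)" "top_corner u \<in> tile_corners (tile u (length u))"
    by (simp_all only: tile_corners_def top_corner_def corner_SW_tile_0 insert_iff simp_thms)
  then have "(0, 0) \<in> snake_vertices u" "top_corner u \<in> snake_vertices u"
    unfolding snake_vertices_def by (auto simp del: tile.simps)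
  moreover have "diag_corner u i b \<in> snake_vertices u" if "i \<le> length u" for i b
    unfolding snake_vertices_def using that diag_corner_mem_tile_corners by (intro UN_I) simp_all
  ultimately show "?V \<subseteq> snake_vertices u" by (intro Un_least insert_subsetI) (auto del: equalityI)
qed

text \<open>Between the antidiagonals of tiles \<open>i\<close> and \<open>i + 1\<close> there are the two upper
edges of tile \<open>i\<close>, which end in the north-east corner of tile \<open>i\<close>, and the
two lower edges of tile \<open>i + 1\<close>, which start in its south-west corner. They share one
edge, so that only one of the four pairs is not joined.\<close>

definition adjacent_corners :: "'a letter list \<Rightarrow> nat \<Rightarrow> bool \<Rightarrow> bool \<Rightarrow> bool" where
  "adjacent_corners u i a b \<longleftrightarrow> a = goes_north u i \<or> b \<noteq> goes_north u i"

lemma snake_edge_cases [consumes 1, case_names bottom middle top]: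
  assumes "e \<in> snake_edges u"
  obtains b where "e = {(0, 0), diag_corner u 0 b}"
    | i a b where "i < length u" "adjacent_corners u i a b"
        "e = {diag_corner u i a, diag_corner u (Suc i) b}"
    | a where "e = {diag_corner u (length u) a, top_corner u}"
proof -
  from assms obtain i where i: "i \<le> length u" and e: "e \<in> tile_edges (tile u i)"
    by (auto simp: snake_edges_def)
  from e consider "e = edge_S (tile u i) \<or> e = edge_W (tile u i)" | "e = edge_N (tile u i) \<or> e = edge_E (tile u i)"
    by (auto simp: tile_edges_def)
  then show thesis
  proof cases
    case 1
    show thesis
    proof (cases i)
      case 0
      show thesis using 1 that(1) unfolding 0 edge_S_tile_0 edge_W_tile_0 by blast
    next
      case (Suc j)
      have "j < length u" "adjacent_corners u j (goes_north u j) b" for b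
        using i Suc by (simp_all add: adjacent_corners_def)
      then show thesis using 1 that(2) unfolding Suc edge_S_tile_Suc edge_W_tile_Suc by blast
    qed
  next
    case 2
    show thesis
    proof (cases "i = length u")
      case True
      show thesis using 2 that(3) unfolding True edge_N_last_tile edge_E_last_tile by blast
    next
      case False
      with i have "i < length u" "adjacent_corners u i a (\<not> goes_north u i)" for a
        by (simp_all add: adjacent_corners_def)
      then show thesis using 2 that(2) unfolding edge_N_tile edge_E_tile by blast
    qed
  qed
qed

text \<open>By the description through antidiagonals, an edge borders no tiles except the two next to its layer;
this determines the boundary of a set of tiles layer by layer.\<close>

lemma mem_tile_edges_bottom:
  "{(0, 0), diag_corner u 0 b} \<in> tile_edges (tile u i) \<longleftrightarrow> i = 0"
proof (cases i)
  case 0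
  then show ?thesis
    unfolding tile_edges_def by (cases b) (simp_all only: 0 edge_S_tile_0 edge_W_tile_0 insert_iff refl simp_thms)
next
  case (Suc j)
  show ?thesis
    unfolding tile_edges_def Suc edge_S_tile_Suc edge_W_tile_Suc edge_N_tile edge_E_tile
    by (simp add: doubleton_eq_iff)
qed

lemma mem_tile_edges_middle:
  "{diag_corner u i a, diag_corner u (Suc i) b} \<in> tile_edges (tile u j) \<longleftrightarrow>
    j = i \<and> b \<noteq> goes_north u i \<or> j = Suc i \<and> a = goes_north u i"
proof (cases j)
  case 0
  show ?thesis
    unfolding tile_edges_def 0 edge_S_tile_0 edge_W_tile_0 edge_N_tile edge_E_tile
    by (cases a; cases b; cases "i = 0"; auto simp: doubleton_eq_iff simp del: goes_north.simps)
next
  case (Suc k)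
  show ?thesis
    unfolding tile_edges_def Suc edge_S_tile_Suc edge_W_tile_Suc edge_N_tile edge_E_tile
    by (cases a; cases b; cases "i = Suc k"; auto simp: doubleton_eq_iff simp del: goes_north.simps)
qed

lemma mem_tile_edges_top:
  assumes "i \<le> length u"
  shows "{diag_corner u (length u) a, top_corner u} \<in> tile_edges (tile u i) \<longleftrightarrow> i = length u"
proof (cases "i = length u")
  case True
  then show ?thesis
    unfolding tile_edges_def True edge_N_last_tile edge_E_last_tile by (cases a) auto
next
  case False
  with assms have i: "i < length u" by simp
  show ?thesis
  proof (cases i)
    case 0
    show ?thesis using i unfolding tile_edges_def 0 edge_S_tile_0 edge_W_tile_0 edge_N_tile edge_E_tile
      by (auto simp: doubleton_eq_iff)
  next
    case (Suc k)
    show ?thesis using i unfolding tile_edges_def Suc edge_S_tile_Suc edge_W_tile_Suc edge_N_tile edge_E_tile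
      by (auto simp: doubleton_eq_iff)
  qed
qed

lemma bottom_mem_snake_edges: "{(0, 0), diag_corner u 0 b} \<in> snake_edges u"
  unfolding snake_edges_def by (intro UN_I[of 0]) (simp_all only: mem_tile_edges_bottom atMost_iff le0)

lemma middle_mem_snake_edges:
  assumes "i < length u" "adjacent_corners u i a b"
  shows "{diag_corner u i a, diag_corner u (Suc i) b} \<in> snake_edges u"
proof -
  from assms(2) have "\<exists>j\<in>{i, Suc i}. {diag_corner u i a, diag_corner u (Suc i) b} \<in> tile_edges (tile u j)"
    unfolding mem_tile_edges_middle adjacent_corners_def by auto
  moreover have "{i, Suc i} \<subseteq> {..length u}" using assms(1) by auto
  ultimately show ?thesis unfolding snake_edges_def by blast
qed

lemma top_mem_snake_edges: "{diag_corner u (length u) a, top_corner u} \<in> snake_edges u"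
  unfolding snake_edges_def by (intro UN_I[of "length u"]) (simp_all only: mem_tile_edges_top atMost_iff le_refl)

text \<open>Tiles are now accessed only through their antidiagonals, without unfolding their coordinates.\<close>

declare goes_north.simps [simp del] tile.simps [simp del]

section \<open>Perfect matchings of the snake graph\<close>

text \<open>For a set \<open>H\<close> of tiles, the corners of the \<open>i\<close>-th antidiagonal that are
matched downwards and upwards. Going from the \<open>i\<close>-th to the next tile, the minimal
matching changes the side of the corner that is matched downwards, whence the parity.\<close>

definition low_corner :: "'a letter list \<Rightarrow> nat set \<Rightarrow> nat \<Rightarrow> point" where
  "low_corner u H i = diag_corner u i (i \<in> H \<longleftrightarrow> even i)"

definition high_corner :: "'a letter list \<Rightarrow> nat set \<Rightarrow> nat \<Rightarrow> point" where
  "high_corner u H i = diag_corner u i (i \<in> H \<longleftrightarrow> odd i)"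

definition ideal_matching :: "'a letter list \<Rightarrow> nat set \<Rightarrow> edge set" where
  "ideal_matching u H = {{(0, 0), low_corner u H 0}, {high_corner u H (length u), top_corner u}} \<union>
     {{high_corner u H i, low_corner u H (Suc i)} | i. i < length u}"

text \<open>The sets closed under all letters of a string, without a letter joining the last index to the first.\<close>

definition string_ideals :: "'a letter list \<Rightarrow> nat set set" where
  "string_ideals u = {H. H \<subseteq> {..length u} \<and>
     (\<forall>i < length u. if snd (u ! i) then i \<in> H \<longrightarrow> Suc i \<in> H else Suc i \<in> H \<longrightarrow> i \<in> H)}"

lemma low_corner_eq_iff [simp]: "low_corner u H i = low_corner u H j \<longleftrightarrow> i = j"
  and high_corner_eq_iff [simp]: "high_corner u H i = high_corner u H j \<longleftrightarrow> i = j"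
  and low_neq_high_corner [simp]: "low_corner u H i \<noteq> high_corner u H j" "high_corner u H i \<noteq> low_corner u H j"
  by (auto simp: low_corner_def high_corner_def)

lemma low_high_neq_ends [simp]:
  "(0, 0) \<noteq> low_corner u H i" "(0, 0) \<noteq> high_corner u H i"
  "low_corner u H i \<noteq> (0, 0)" "high_corner u H i \<noteq> (0, 0)"
  "i \<le> length u \<Longrightarrow> low_corner u H i \<noteq> top_corner u"
  "i \<le> length u \<Longrightarrow> high_corner u H i \<noteq> top_corner u"
  "i \<le> length u \<Longrightarrow> top_corner u \<noteq> low_corner u H i"
  "i \<le> length u \<Longrightarrow> top_corner u \<noteq> high_corner u H i"
  by (simp_all add: low_corner_def high_corner_def)

lemma diag_corner_low_or_high: "diag_corner u i b = low_corner u H i \<or> diag_corner u i b = high_corner u H i"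
  by (auto simp: low_corner_def high_corner_def)

lemma middle_mem_snake_edges_iff:
  assumes "i < length u"
  shows "{diag_corner u i a, diag_corner u (Suc i) b} \<in> snake_edges u \<longleftrightarrow> adjacent_corners u i a b"
proof
  assume "{diag_corner u i a, diag_corner u (Suc i) b} \<in> snake_edges u"
  then show "adjacent_corners u i a b"
    using assms by (cases rule: snake_edge_cases) (auto simp: doubleton_eq_iff)
qed (rule middle_mem_snake_edges[OF assms])

text \<open>The one missing edge between two consecutive antidiagonals is the one that the matching of
\<open>H\<close> would need if \<open>H\<close> were not closed under the letter between the two
tiles.\<close>

lemma adjacent_high_low_iff:
  "adjacent_corners u i (i \<in> H \<longleftrightarrow> odd i) (Suc i \<in> H \<longleftrightarrow> odd i) \<longleftrightarrow>
    (if snd (u ! i) then i \<in> H \<longrightarrow> Suc i \<in> H else Suc i \<in> H \<longrightarrow> i \<in> H)"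
  by (auto simp: adjacent_corners_def goes_north_iff)

lemma high_low_mem_snake_edges_iff:
  assumes "i < length u"
  shows "{high_corner u H i, low_corner u H (Suc i)} \<in> snake_edges u \<longleftrightarrow>
    (if snd (u ! i) then i \<in> H \<longrightarrow> Suc i \<in> H else Suc i \<in> H \<longrightarrow> i \<in> H)"
  unfolding high_corner_def low_corner_def middle_mem_snake_edges_iff[OF assms] even_Suc adjacent_high_low_iff ..

lemma ideal_matching_subset_iff:
  assumes "H \<subseteq> {..length u}"
  shows "ideal_matching u H \<subseteq> snake_edges u \<longleftrightarrow> H \<in> string_ideals u"
proof -
  have "{(0, 0), low_corner u H 0} \<in> snake_edges u" "{high_corner u H (length u), top_corner u} \<in> snake_edges u"
    unfolding low_corner_def high_corner_def by (rule bottom_mem_snake_edges top_mem_snake_edges)+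
  then have "ideal_matching u H \<subseteq> snake_edges u \<longleftrightarrow>
      (\<forall>i < length u. {high_corner u H i, low_corner u H (Suc i)} \<in> snake_edges u)"
    unfolding ideal_matching_def by blast
  then show ?thesis
    using assms by (simp add: high_low_mem_snake_edges_iff string_ideals_def)
qed

lemma ideal_matching_disjoint:
  assumes "e \<in> ideal_matching u H" "e' \<in> ideal_matching u H" "v \<in> e" "v \<in> e'"
  shows "e = e'"
  using assms unfolding ideal_matching_def by auto

text \<open>Every corner of an antidiagonal is either the low corner, covered by the edge that comes from the
layer below, or the high corner, covered by the edge to the layer above.\<close>

lemma ideal_matching_covers:
  assumes "v \<in> snake_vertices u"
  shows "\<exists>e \<in> ideal_matching u H. v \<in> e"
proof -
  have "\<exists>e \<in> ideal_matching u H. low_corner u H i \<in> e" if "i \<le> length u" for i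
  proof (cases i)
    case (Suc j)
    then have "{high_corner u H j, low_corner u H i} \<in> ideal_matching u H"
      using that unfolding ideal_matching_def by auto
    then show ?thesis by blast
  qed (auto simp: ideal_matching_def)
  moreover have "\<exists>e \<in> ideal_matching u H. high_corner u H i \<in> e" if "i \<le> length u" for i
  proof (cases "i = length u")
    case False
    then have "{high_corner u H i, low_corner u H (Suc i)} \<in> ideal_matching u H"
      using that unfolding ideal_matching_def by auto
    then show ?thesis by blast
  qed (auto simp: ideal_matching_def)
  moreover have "\<exists>e \<in> ideal_matching u H. (0, 0) \<in> e" "\<exists>e \<in> ideal_matching u H. top_corner u \<in> e"
    by (auto simp: ideal_matching_def)
  ultimately show ?thesis
    using assms diag_corner_low_or_high[of u _ _ H] unfolding snake_vertices_layered
    by (smt (verit) UnE insertE mem_Collect_eq singletonD)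
qed

lemma snake_matching_ideal_matching:
  assumes "H \<in> string_ideals u"
  shows "snake_matching u (ideal_matching u H)"
proof -
  have "H \<subseteq> {..length u}" using assms by (simp add: string_ideals_def)
  then show ?thesis
    unfolding snake_matching_def perfect_matching_def
    using ideal_matching_subset_iff assms ideal_matching_covers ideal_matching_disjoint by metis
qed

lemma snake_matching_unique:
  assumes "snake_matching u P" "v \<in> snake_vertices u" "e \<in> P" "e' \<in> P" "v \<in> e" "v \<in> e'"
  shows "e = e'"
  using assms unfolding snake_matching_def perfect_matching_def by blast

text \<open>By induction on the layers, exactly one corner of each antidiagonal is matched with the layer
below: the other one is matched with the layer above, and uses up one corner there.  Recording
which corner is matched downwards gives \<open>H\<close>.\<close>

lemma snake_matching_is_ideal_matching:
  assumes P: "snake_matching u P"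
  shows "\<exists>H \<in> string_ideals u. P = ideal_matching u H"
proof -
  let ?n = "length u" and ?D = "diag_corner u"
  have sub: "P \<subseteq> snake_edges u"
    using P unfolding snake_matching_def perfect_matching_def by blast
  have cover: "\<exists>e \<in> P. v \<in> e" if "v \<in> snake_vertices u" for v
    using P that unfolding snake_matching_def perfect_matching_def by blast
  have vert: "(0, 0) \<in> snake_vertices u" "i \<le> ?n \<Longrightarrow> ?D i b \<in> snake_vertices u" for i b
    unfolding snake_vertices_layered by auto
  \<comment> \<open>The corner \<open>?D i b\<close> is on layer \<open>i + 1\<close>; it is matched downwards iff its edge meets layer \<open>i\<close>.\<close>
  define down where "down i b \<longleftrightarrow> (\<exists>e \<in> P. ?D i b \<in> e \<and> (\<exists>p \<in> e. level p = i))" for i b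
  have not_up: "\<not> (\<exists>e \<in> P. ?D i b \<in> e \<and> (\<exists>p \<in> e. level p = i + 2))" if down: "down i b" and i: "i \<le> ?n" for i b
  proof
    assume "\<exists>e \<in> P. ?D i b \<in> e \<and> (\<exists>p \<in> e. level p = i + 2)"
    then obtain e p where e: "e \<in> P" "?D i b \<in> e" "p \<in> e" "level p = i + 2" by blast
    from down obtain e' p' where e': "e' \<in> P" "?D i b \<in> e'" "p' \<in> e'" "level p' = i"
      unfolding down_def by blast
    have "e = e'"
      using snake_matching_unique[OF P] vert(2)[OF i] e(1,2) e'(1,2) by blast
    then have p: "p \<in> e" "p' \<in> e" "e \<in> snake_edges u" using e e' sub by auto
    from p(3) show False
      using p(1,2) e(4) e'(4) by (cases rule: snake_edge_cases) auto
  qed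
  have down_0: "down 0 b \<longleftrightarrow> {(0, 0), ?D 0 b} \<in> P" for b
  proof
    assume "down 0 b"
    then obtain e p where e: "e \<in> P" "?D 0 b \<in> e" "p \<in> e" "level p = 0" unfolding down_def by blast
    with sub have "e \<in> snake_edges u" by blast
    then have "e = {(0, 0), ?D 0 b}" using e(2-4) by (cases rule: snake_edge_cases) auto
    with e show "{(0, 0), ?D 0 b} \<in> P" by simp
  qed (auto simp: down_def intro!: bexI[of _ "{(0, 0), ?D 0 b}"])
  have down_Suc: "down (Suc i) b \<longleftrightarrow> (\<exists>a. {?D i a, ?D (Suc i) b} \<in> P)" if i: "Suc i \<le> ?n" for i b
  proof
    assume "down (Suc i) b"
    then obtain e p where e: "e \<in> P" "?D (Suc i) b \<in> e" "p \<in> e" "level p = Suc i" unfolding down_def by blast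
    with sub have "e \<in> snake_edges u" by blast
    then have "\<exists>a. e = {?D i a, ?D (Suc i) b}"
      using e(2-4) i by (cases rule: snake_edge_cases) auto
    with e show "\<exists>a. {?D i a, ?D (Suc i) b} \<in> P" by auto
  next
    assume "\<exists>a. {?D i a, ?D (Suc i) b} \<in> P"
    then obtain a where "{?D i a, ?D (Suc i) b} \<in> P" ..
    then show "down (Suc i) b"
      unfolding down_def by (intro bexI[of _ "{?D i a, ?D (Suc i) b}"]) auto
  qed
  have one_down: "down i True \<noteq> down i False" if "i \<le> ?n" for i
    using that
  proof (induction i)
    case 0
    obtain e where e: "e \<in> P" "(0, 0) \<in> e" using cover vert(1) by blast
    with sub have "e \<in> snake_edges u" by blast
    then obtain b where b: "e = {(0, 0), ?D 0 b}"
      using e(2) by (cases rule: snake_edge_cases) auto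
    have "\<not> down 0 (\<not> b)"
    proof
      assume "down 0 (\<not> b)"
      then have "{(0, 0), ?D 0 (\<not> b)} = {(0, 0), ?D 0 b}"
        unfolding down_0 using snake_matching_unique[OF P vert(1)] e b by blast
      then show False by (simp add: doubleton_eq_iff)
    qed
    moreover have "down 0 b" using e b down_0 by simp
    ultimately show ?case by (cases b) auto
  next
    case (Suc i)
    then obtain b where b: "down i b" "\<not> down i (\<not> b)" by (metis (full_types) Suc_leD)
    obtain e where e: "e \<in> P" "?D i (\<not> b) \<in> e" using cover[OF vert(2)[of i "\<not> b"]] Suc.prems by auto
    with sub have "e \<in> snake_edges u" by blast
    then obtain c where c: "e = {?D i (\<not> b), ?D (Suc i) c}"
    proof (cases rule: snake_edge_cases)
      case (bottom a)
      then show thesis using e b(2) unfolding down_def by auto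
    next
      case (middle j a c)
      show thesis
      proof (cases "j = i")
        case True
        then show thesis using middle e that by auto
      next
        case False
        then have "i = Suc j" using middle e by auto
        then have "down i (\<not> b)" using middle e unfolding down_def by auto
        then show thesis using b(2) by simp
      qed
    next
      case (top a)
      then show thesis using e Suc.prems by auto
    qed
    have "\<not> down (Suc i) (\<not> c)"
    proof
      assume "down (Suc i) (\<not> c)"
      then obtain a where a: "{?D i a, ?D (Suc i) (\<not> c)} \<in> P" using down_Suc[OF Suc.prems] by blast
      then have "a \<noteq> b" using not_up[OF b(1)] Suc.prems by fastforce
      then have "{?D i a, ?D (Suc i) (\<not> c)} = e"
        using snake_matching_unique[OF P vert(2)[of i "\<not> b"]] a e Suc.prems by simp
      then show False unfolding c by (auto simp: doubleton_eq_iff)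
    qed
    moreover have "down (Suc i) c" using e c down_Suc[OF Suc.prems] by auto
    ultimately show ?case by (cases c) auto
  qed
  define H where "H = {i. i \<le> ?n \<and> down i (even i)}"
  have low: "?D i b = low_corner u H i" if "down i b" "i \<le> ?n" for i b
    using one_down[OF that(2)] that unfolding H_def low_corner_def by (cases b; cases "even i") auto
  have high: "?D i b = high_corner u H i" if "e \<in> P" "?D i b \<in> e" "p \<in> e" "level p = i + 2" "i \<le> ?n" for e p i b
  proof -
    have "\<not> down i b" using not_up that by blast
    then show ?thesis
      using one_down[OF that(5)] that unfolding H_def high_corner_def by (cases b; cases "even i") auto
  qed
  \<comment> \<open>Both sides are perfect matchings, so the converse inclusion follows from this one.\<close>
  have sub_M: "P \<subseteq> ideal_matching u H"
  proof
    fix e assume e: "e \<in> P"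
    with sub have "e \<in> snake_edges u" by blast
    then show "e \<in> ideal_matching u H"
    proof (cases rule: snake_edge_cases)
      case (bottom b)
      then show ?thesis using low[of 0 b] e unfolding down_0 ideal_matching_def by simp
    next
      case (middle i a b)
      have "?D (Suc i) b = low_corner u H (Suc i)"
        using middle e by (intro low) (auto simp: down_Suc)
      moreover have "?D i a = high_corner u H i"
        using middle e by (intro high[of e _ _ "?D (Suc i) b"]) auto
      ultimately show ?thesis using middle unfolding ideal_matching_def by auto
    next
      case (top a)
      then have "?D ?n a = high_corner u H ?n"
        using e by (intro high[of e _ _ "top_corner u"]) auto
      then show ?thesis using top unfolding ideal_matching_def by simp
    qed
  qed
  have "e \<in> P" if e: "e \<in> ideal_matching u H" for e
  proof -
    have "\<exists>v \<in> e. v \<in> snake_vertices u"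
      using e unfolding ideal_matching_def low_corner_def high_corner_def
      by (auto simp: vert)
    then obtain v where v: "v \<in> e" "v \<in> snake_vertices u" by blast
    then obtain e' where "e' \<in> P" "v \<in> e'" using cover by blast
    with ideal_matching_disjoint[OF e _ v(1)] sub_M show ?thesis by blast
  qed
  with sub_M have "P = ideal_matching u H" by blast
  moreover have "H \<subseteq> {..?n}" by (auto simp: H_def)
  ultimately show ?thesis using sub ideal_matching_subset_iff by blast
qed

lemma bottom_mem_ideal_matching:
  "{(0, 0), diag_corner u 0 b} \<in> ideal_matching u H \<longleftrightarrow> b = (0 \<in> H)"
  by (auto simp: ideal_matching_def low_corner_def high_corner_def doubleton_eq_iff)

lemma middle_mem_ideal_matching:
  assumes "i < length u"
  shows "{diag_corner u i a, diag_corner u (Suc i) b} \<in> ideal_matching u H \<longleftrightarrow>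
    a = (i \<in> H \<longleftrightarrow> odd i) \<and> b = (Suc i \<in> H \<longleftrightarrow> odd i)"
  using assms by (auto simp: ideal_matching_def low_corner_def high_corner_def doubleton_eq_iff)

lemma top_mem_ideal_matching:
  "{diag_corner u (length u) a, top_corner u} \<in> ideal_matching u H \<longleftrightarrow> a = (length u \<in> H \<longleftrightarrow> odd (length u))"
  by (auto simp: ideal_matching_def low_corner_def high_corner_def doubleton_eq_iff)

lemma bottom_mem_tiles_boundary:
  "{(0, 0), diag_corner u 0 b} \<in> tiles_boundary u H \<longleftrightarrow> 0 \<in> H"
  unfolding tiles_boundary_def mem_Collect_eq mem_tile_edges_bottom by blast

lemma middle_mem_tiles_boundary:
  "{diag_corner u i a, diag_corner u (Suc i) b} \<in> tiles_boundary u H \<longleftrightarrow>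
    (i \<in> H \<and> b \<noteq> goes_north u i) \<noteq> (Suc i \<in> H \<and> a = goes_north u i)"
proof -
  have "(\<exists>!j. j = i \<and> A \<or> j = Suc i \<and> B) \<longleftrightarrow> A \<noteq> B" for A B
    by (cases A; cases B) (auto dest: spec[of _ i] spec[of _ "Suc i"])
  moreover have "j \<in> H \<and> {diag_corner u i a, diag_corner u (Suc i) b} \<in> tile_edges (tile u j) \<longleftrightarrow>
      j = i \<and> (i \<in> H \<and> b \<noteq> goes_north u i) \<or> j = Suc i \<and> (Suc i \<in> H \<and> a = goes_north u i)" for j
    unfolding mem_tile_edges_middle by blast
  ultimately show ?thesis unfolding tiles_boundary_def mem_Collect_eq by presburger
qed

lemma top_mem_tiles_boundary:
  assumes "H \<subseteq> {..length u}"
  shows "{diag_corner u (length u) a, top_corner u} \<in> tiles_boundary u H \<longleftrightarrow> length u \<in> H"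
proof -
  have "i \<in> H \<and> {diag_corner u (length u) a, top_corner u} \<in> tile_edges (tile u i) \<longleftrightarrow>
      i \<in> H \<and> i = length u" for i
    using assms mem_tile_edges_top[of i u a] by (cases "i \<in> H") auto
  then show ?thesis unfolding tiles_boundary_def mem_Collect_eq by auto
qed

lemma tiles_boundary_subset: "H \<subseteq> {..length u} \<Longrightarrow> tiles_boundary u H \<subseteq> snake_edges u"
  unfolding tiles_boundary_def snake_edges_def by blast

text \<open>The bottom edges of the snake graph show whether the first tile is enclosed, and the edge shared by
two consecutive tiles shows whether exactly one of them is.\<close>

lemma tiles_boundary_inj:
  assumes "H \<subseteq> {..length u}" "H' \<subseteq> {..length u}" "tiles_boundary u H = tiles_boundary u H'"
  shows "H = H'"
proof -
  have "i \<in> H \<longleftrightarrow> i \<in> H'" if "i \<le> length u" for i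
    using that
  proof (induction i)
    case 0
    show ?case using bottom_mem_tiles_boundary[of u True] assms(3) by metis
  next
    case (Suc i)
    then show ?case
      using middle_mem_tiles_boundary[of u i "goes_north u i" "\<not> goes_north u i"] assms(3) by (metis Suc_leD)
  qed
  with assms(1,2) show ?thesis by blast
qed

lemma empty_mem_string_ideals: "{} \<in> string_ideals u"
  by (simp add: string_ideals_def)

text \<open>The edge between two consecutive antidiagonals is a boundary edge iff both or none of the two tiles
belong to the ideal.  So a matching by boundary edges comes from the empty set or from the set of all
tiles, and the south edge of the first tile decides between them.\<close>

lemma minimal_matching_eq: "minimal_matching u = ideal_matching u {}"
  unfolding minimal_matching_def
proof (rule the_equality)
  have "ideal_matching u {} \<subseteq> tiles_boundary u {..length u}"
  proof
    fix e assume e: "e \<in> ideal_matching u {}"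
    then have "e \<in> snake_edges u"
      using ideal_matching_subset_iff empty_mem_string_ideals by blast
    then show "e \<in> tiles_boundary u {..length u}"
      using e by (cases rule: snake_edge_cases)
        (auto simp: bottom_mem_tiles_boundary middle_mem_tiles_boundary top_mem_tiles_boundary middle_mem_ideal_matching)
  qed
  then show "snake_matching u (ideal_matching u {}) \<and> ideal_matching u {} \<subseteq> tiles_boundary u {..length u} \<and>
      edge_S (tile u 0) \<in> ideal_matching u {}"
    unfolding edge_S_tile_0 bottom_mem_ideal_matching
    by (simp add: snake_matching_ideal_matching empty_mem_string_ideals)
next
  fix P assume P: "snake_matching u P \<and> P \<subseteq> tiles_boundary u {..length u} \<and> edge_S (tile u 0) \<in> P"
  then obtain H where H: "H \<in> string_ideals u" "P = ideal_matching u H"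
    using snake_matching_is_ideal_matching by blast
  have "i \<notin> H" if "i \<le> length u" for i
    using that
  proof (induction i)
    case 0
    show ?case using P unfolding H(2) edge_S_tile_0 bottom_mem_ideal_matching by simp
  next
    case (Suc i)
    then have i: "i < length u" by simp
    have "{diag_corner u i (i \<in> H \<longleftrightarrow> odd i), diag_corner u (Suc i) (Suc i \<in> H \<longleftrightarrow> odd i)} \<in> P"
      unfolding H(2) middle_mem_ideal_matching[OF i] by simp
    with P have "{diag_corner u i (i \<in> H \<longleftrightarrow> odd i), diag_corner u (Suc i) (Suc i \<in> H \<longleftrightarrow> odd i)} \<in>
        tiles_boundary u {..length u}" by blast
    then show ?case using Suc i unfolding middle_mem_tiles_boundary by auto
  qed
  with H(1) have "H = {}" by (auto simp: string_ideals_def)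
  then show "P = ideal_matching u {}" using H(2) by simp
qed

text \<open>An edge other than those at the two ends belongs to two tiles or to one, according to whether it is
the edge shared by the tiles next to its layer. On each layer the claim is a statement about the
membership of these two tiles in \<open>H\<close>, the sign of the letter between them and a parity.\<close>

lemma sym_diff_minimal_matching:
  assumes H: "H \<in> string_ideals u"
  shows "sym_diff (ideal_matching u H) (minimal_matching u) = tiles_boundary u H"
proof (rule Set.set_eqI)
  fix e
  have sub: "H \<subseteq> {..length u}" using H by (simp add: string_ideals_def)
  show "e \<in> sym_diff (ideal_matching u H) (minimal_matching u) \<longleftrightarrow> e \<in> tiles_boundary u H"
  proof (cases "e \<in> snake_edges u")
    case False
    then show ?thesis
      using ideal_matching_subset_iff[of _ u] H sub empty_mem_string_ideals[of u] tiles_boundary_subset[OF sub]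
      unfolding minimal_matching_eq by blast
  next
    case True
    then show ?thesis
    proof (cases rule: snake_edge_cases)
      case (middle i a b)
      have "if snd (u ! i) then i \<in> H \<longrightarrow> Suc i \<in> H else Suc i \<in> H \<longrightarrow> i \<in> H"
        using H middle(1) by (simp add: string_ideals_def)
      moreover have "a = goes_north u i \<or> b \<noteq> goes_north u i"
        using middle(2) by (simp add: adjacent_corners_def)
      ultimately show ?thesis
        using middle(1) unfolding middle(3) minimal_matching_eq goes_north_iff
        by (auto simp: middle_mem_ideal_matching middle_mem_tiles_boundary goes_north_iff)
    qed (use sub in \<open>auto simp: minimal_matching_eq bottom_mem_ideal_matching top_mem_ideal_matching
        bottom_mem_tiles_boundary top_mem_tiles_boundary\<close>)
  qed
qed

lemma enclosed_tiles_ideal_matching: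
  assumes H: "H \<in> string_ideals u"
  shows "enclosed_tiles u (ideal_matching u H) = H"
  unfolding enclosed_tiles_def sym_diff_minimal_matching[OF H]
proof (rule the_equality)
  show "H \<subseteq> {..length u} \<and> tiles_boundary u H = tiles_boundary u H"
    using H by (simp add: string_ideals_def)
  fix H' assume "H' \<subseteq> {..length u} \<and> tiles_boundary u H = tiles_boundary u H'"
  then show "H' = H"
    using H by (intro tiles_boundary_inj[of H' u H]) (simp_all add: string_ideals_def)
qed

section \<open>Good matchings of the band graph\<close>

text \<open>A matching of the snake graph descends to the band graph by identifying the two copies of the cut
edge if it contains both, and by omitting the copy of the cut edge if it contains only one: in this
case its end points are covered in the band graph by the edges that cover the other copy.\<close>

definition glue_matching :: "'a letter list \<Rightarrow> edge set \<Rightarrow> edge set set" where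
  "glue_matching w P = (\<lambda>e. {e}) ` (P - {first_cut w, last_cut w}) \<union>
     (if {first_cut w, last_cut w} \<subseteq> P then {cut_edge w} else {})"

definition contains_cut :: "'a letter list \<Rightarrow> edge set \<Rightarrow> bool" where
  "contains_cut w P \<longleftrightarrow> first_cut w \<in> P \<or> last_cut w \<in> P"

lemma ex1_insert_satisfying:
  assumes "x \<notin> A" "P x"
  shows "(\<exists>!e. e \<in> insert x A \<and> P e) \<longleftrightarrow> (\<forall>e \<in> A. \<not> P e)"
  using assms by (metis insert_iff)

lemma ex1_insert_violating:
  assumes "\<not> P x"
  shows "(\<exists>!e. e \<in> insert x A \<and> P e) \<longleftrightarrow> (\<exists>!e. e \<in> A \<and> P e)"
  using assms by (metis insert_iff)

lemma ex1_singleton_image: "(\<exists>!e. e \<in> (\<lambda>x. {x}) ` A \<and> P e) \<longleftrightarrow> (\<exists>!x. x \<in> A \<and> P {x})"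
  by (smt (verit) image_iff singleton_inject)

lemma ball_if_mem:
  assumes "S \<subseteq> V"
  shows "(\<forall>v \<in> V. if v \<in> S then A v else B v) \<longleftrightarrow> (\<forall>v \<in> S. A v) \<and> (\<forall>v \<in> V - S. B v)"
  using assms by (auto split: if_splits)

text \<open>The word \<open>w\<close> has letters of both signs. The snake graph is that of \<open>u\<close>
with tiles \<open>0, \<dots>, n\<close>, and the sign \<open>closing\<close> of the last letter of
\<open>w\<close> determines how the snake is closed up.\<close>

locale mixed_word =
  fixes w :: "'a letter list"
  assumes both_signs: "\<exists>l \<in> set w. snd l = s"
begin

abbreviation "u \<equiv> butlast w"
abbreviation "n \<equiv> length u"
abbreviation "D \<equiv> diag_corner u"
abbreviation "fc \<equiv> first_cut w"
abbreviation "lc \<equiv> last_cut w"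
abbreviation "closing \<equiv> snd (last w)"

lemma w_nonempty: "w \<noteq> []"
  using both_signs[of True] by auto

lemma length_w: "length w = Suc n"
  using w_nonempty by simp

text \<open>The number \<open>n\<close> is to be treated as atomic, not as \<open>length w - 1\<close>.\<close>

declare length_butlast [simp del]

lemma nth_closing: "w ! n = last w"
  using w_nonempty by (simp add: last_conv_nth length_butlast)

lemma n_pos: "0 < n"
proof (rule ccontr)
  assume "\<not> 0 < n"
  then have "length w = 1" using length_w by simp
  then obtain l where "w = [l]" by (auto simp: length_Suc_conv)
  then show False using both_signs[of True] both_signs[of False] by simp
qed

text \<open>For two letters, having both signs means that the signs are different.\<close>

lemma first_letter_neq_closing:
  assumes "n = 1"
  shows "snd (u ! 0) \<noteq> closing"
proof -
  have "length w = 2" using length_w assms by simp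
  then obtain k l where "w = [k, l]" by (auto simp: length_Suc_conv numeral_2_eq_2)
  then show ?thesis using both_signs[of True] both_signs[of False] by auto
qed

lemma first_cut_eq: "fc = {(0, 0), D 0 closing}"
  unfolding first_cut_def first_tile_def edge_W_tile_0 edge_S_tile_0 by simp

lemma last_tile_eq: "last_tile w = tile u n"
  by (simp add: last_tile_def length_w)

text \<open>The last cut edge is the upper edge of the last tile on which one more tile would be glued if
the snake continued with the letter \<open>last w\<close>.\<close>

lemma last_cut_eq: "lc = {D n (closing \<longleftrightarrow> even n), top_corner u}"
  unfolding last_cut_def last_tile_eq edge_N_last_tile edge_E_last_tile length_w by auto

lemma cut_point_x_eq: "cut_point_x w = {(0, 0), D n (closing \<longleftrightarrow> even n)}"
proof -
  have "corner_NE (last_tile w) = top_corner u" by (simp add: last_tile_eq top_corner_def)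
  moreover have "corner_SW (first_tile w) = (0, 0)" unfolding first_tile_def by (rule corner_SW_tile_0)
  ultimately show ?thesis unfolding cut_point_x_def last_cut_eq by auto
qed

lemma cut_point_y_eq: "cut_point_y w = {D 0 closing, top_corner u}"
proof -
  have "corner_NE (last_tile w) = top_corner u" by (simp add: last_tile_eq top_corner_def)
  moreover have "corner_SW (first_tile w) = (0, 0)" unfolding first_tile_def by (rule corner_SW_tile_0)
  ultimately show ?thesis unfolding cut_point_y_def first_cut_eq by auto
qed

lemma cuts_disjoint: "fc \<inter> lc = {}"
  using n_pos unfolding first_cut_eq last_cut_eq by auto

lemma cut_points_disjoint: "cut_point_x w \<inter> cut_point_y w = {}"
  using n_pos unfolding cut_point_x_eq cut_point_y_eq by auto

lemma cuts_neq: "fc \<noteq> lc"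
  using cuts_disjoint unfolding first_cut_eq by auto

lemma cut_points_Un: "cut_point_x w \<union> cut_point_y w = fc \<union> lc"
  unfolding cut_point_x_eq cut_point_y_eq first_cut_eq last_cut_eq by blast

lemma cuts_mem_snake_edges: "fc \<in> snake_edges u" "lc \<in> snake_edges u"
  unfolding first_cut_eq last_cut_eq by (rule bottom_mem_snake_edges top_mem_snake_edges)+

lemma cut_vertices: "fc \<union> lc \<subseteq> snake_vertices u"
  unfolding first_cut_eq last_cut_eq snake_vertices_layered by auto

text \<open>For layer reasons, an edge that is not a copy of the cut edge can contain two of the four points
only if there are just two tiles. Then it would join the antidiagonals of both tiles, where the
missing edge is the one in question because the two letters have different signs.\<close>

lemma cut_points_separated:
  assumes e: "e \<in> snake_edges u" "e \<noteq> fc" "e \<noteq> lc" and pq: "p \<in> e" "q \<in> e" "p \<in> fc \<union> lc" "q \<in> fc \<union> lc"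
  shows "p = q"
  using e(1)
proof (cases rule: snake_edge_cases)
  case (bottom b)
  then have "b \<noteq> closing" using e(2) by (auto simp: first_cut_eq)
  then show ?thesis using pq n_pos unfolding bottom first_cut_eq last_cut_eq by auto
next
  case (top b)
  then have "b \<noteq> (closing \<longleftrightarrow> even n)" using e(3) unfolding last_cut_eq by blast
  then show ?thesis using pq n_pos unfolding top first_cut_eq last_cut_eq by auto
next
  case (middle i a b)
  have lower: "i = 0 \<and> a = closing" if "D i a \<in> fc \<union> lc"
    using that middle(1) unfolding first_cut_eq last_cut_eq by auto
  have upper: "Suc i = n \<and> b = (closing \<longleftrightarrow> even n)" if "D (Suc i) b \<in> fc \<union> lc"
    using that middle(1) unfolding first_cut_eq last_cut_eq by auto
  have "\<not> (D i a \<in> fc \<union> lc \<and> D (Suc i) b \<in> fc \<union> lc)"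
  proof
    assume "D i a \<in> fc \<union> lc \<and> D (Suc i) b \<in> fc \<union> lc"
    then have "i = 0" "a = closing" "n = 1" "b = (closing \<longleftrightarrow> even n)" using lower upper by auto
    then show False
      using middle(2) first_letter_neq_closing unfolding adjacent_corners_def goes_north_iff by auto
  qed
  then show ?thesis using pq unfolding middle(3) by auto
qed

lemma glue_vertex_eq:
  "glue_vertex w v = (if v \<in> cut_point_x w then cut_point_x w
     else if v \<in> cut_point_y w then cut_point_y w else {v})"
  by (simp add: glue_vertex_def)

lemma band_edges_eq: "band_edges w = insert (cut_edge w) ((\<lambda>e. {e}) ` (snake_edges u - {fc, lc}))"
  unfolding band_edges_def glue_edge_def cut_edge_def using cuts_mem_snake_edges by auto

lemma single_neq_cut_edge: "{e} \<noteq> cut_edge w"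
  using cuts_neq unfolding cut_edge_def by auto

text \<open>The copies of the cut edge are disjoint, so the remaining edges of a perfect matching cover exactly
once each vertex that is not on a chosen copy, and avoid the vertices on it.\<close>

lemma snake_matching_split:
  assumes R: "R \<subseteq> snake_edges u - {fc, lc}" and A: "A \<subseteq> {fc, lc}"
  shows "snake_matching u (R \<union> A) \<longleftrightarrow>
    (\<forall>v \<in> snake_vertices u. if v \<in> \<Union>A then \<forall>e \<in> R. v \<notin> e else \<exists>!e. e \<in> R \<and> v \<in> e)"
proof -
  have "(\<exists>!e. e \<in> R \<union> A \<and> v \<in> e) \<longleftrightarrow> (if v \<in> \<Union>A then \<forall>e \<in> R. v \<notin> e else \<exists>!e. e \<in> R \<and> v \<in> e)" for v
  proof (cases "v \<in> \<Union>A")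
    case True
    then obtain c where c: "c \<in> A" "v \<in> c" by blast
    have unique: "c' = c" if "c' \<in> A" "v \<in> c'" for c'
    proof (rule ccontr)
      assume "c' \<noteq> c"
      then have "c' \<inter> c = {}" using that(1) c(1) A cuts_disjoint by auto
      then show False using that(2) c(2) by auto
    qed
    have "c \<notin> R" using c(1) R A by auto
    have "(\<exists>!e. e \<in> R \<union> A \<and> v \<in> e) \<longleftrightarrow> (\<forall>e \<in> R. v \<notin> e)"
    proof
      assume "\<exists>!e. e \<in> R \<union> A \<and> v \<in> e"
      then have "e = c" if "e \<in> R" "v \<in> e" for e using that c by (metis Un_iff)
      then show "\<forall>e \<in> R. v \<notin> e" using \<open>c \<notin> R\<close> by metis
    next
      assume avoid: "\<forall>e \<in> R. v \<notin> e"
      show "\<exists>!e. e \<in> R \<union> A \<and> v \<in> e"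
      proof (rule ex1I[of _ c])
        show "c \<in> R \<union> A \<and> v \<in> c" using c by simp
        show "e = c" if "e \<in> R \<union> A \<and> v \<in> e" for e using that avoid unique[of e] by blast
      qed
    qed
    then show ?thesis using True by simp
  next
    case False
    then have "e \<in> R \<union> A \<and> v \<in> e \<longleftrightarrow> e \<in> R \<and> v \<in> e" for e by auto
    then show ?thesis using False by simp
  qed
  moreover have "R \<union> A \<subseteq> snake_edges u" using R A cuts_mem_snake_edges by auto
  ultimately show ?thesis unfolding snake_matching_def perfect_matching_def by simp
qed

lemma good_matching_with_cut:
  assumes R: "R \<subseteq> snake_edges u - {fc, lc}"
  shows "good_matching w (insert (cut_edge w) ((\<lambda>e. {e}) ` R)) \<longleftrightarrow> snake_matching u (R \<union> {fc, lc})"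
proof -
  have "(\<exists>!e. e \<in> insert (cut_edge w) ((\<lambda>e. {e}) ` R) \<and> band_incident (glue_vertex w v) e) \<longleftrightarrow>
      (if v \<in> fc \<union> lc then \<forall>e \<in> R. glue_vertex w v \<inter> e = {} else \<exists>!e. e \<in> R \<and> v \<in> e)" for v
  proof (cases "v \<in> fc \<union> lc")
    case True
    then have "band_incident (glue_vertex w v) (cut_edge w)"
      unfolding band_incident_def glue_vertex_eq cut_edge_def using cut_points_Un by auto
    moreover have "cut_edge w \<notin> (\<lambda>e. {e}) ` R" using single_neq_cut_edge by blast
    ultimately have "(\<exists>!e. e \<in> insert (cut_edge w) ((\<lambda>e. {e}) ` R) \<and> band_incident (glue_vertex w v) e) \<longleftrightarrow>
        (\<forall>e \<in> (\<lambda>e. {e}) ` R. \<not> band_incident (glue_vertex w v) e)" by (intro ex1_insert_satisfying)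
    then show ?thesis using True by (simp add: band_incident_def)
  next
    case False
    then have v: "glue_vertex w v = {v}" using cut_points_Un by (auto simp: glue_vertex_eq)
    have "\<not> band_incident {v} (cut_edge w)"
      using False by (simp add: band_incident_def cut_edge_def)
    then have "(\<exists>!e. e \<in> insert (cut_edge w) ((\<lambda>e. {e}) ` R) \<and> band_incident {v} e) \<longleftrightarrow>
        (\<exists>!e. e \<in> (\<lambda>e. {e}) ` R \<and> band_incident {v} e)" by (rule ex1_insert_violating)
    also have "\<dots> \<longleftrightarrow> (\<exists>!e. e \<in> R \<and> v \<in> e)" unfolding ex1_singleton_image by (simp add: band_incident_def)
    finally show ?thesis using False v by simp
  qed
  moreover have "insert (cut_edge w) ((\<lambda>e. {e}) ` R) \<subseteq> band_edges w"
    unfolding band_edges_eq using R by blast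
  ultimately have "good_matching w (insert (cut_edge w) ((\<lambda>e. {e}) ` R)) \<longleftrightarrow>
      (\<forall>v \<in> snake_vertices u. if v \<in> fc \<union> lc then \<forall>e \<in> R. glue_vertex w v \<inter> e = {} else \<exists>!e. e \<in> R \<and> v \<in> e)"
    unfolding good_matching_def perfect_matching_def band_vertices_def by simp
  also have "\<dots> \<longleftrightarrow> (\<forall>v \<in> snake_vertices u. if v \<in> fc \<union> lc then \<forall>e \<in> R. v \<notin> e else \<exists>!e. e \<in> R \<and> v \<in> e)"
  proof -
    have "(\<forall>v \<in> fc \<union> lc. \<forall>e \<in> R. glue_vertex w v \<inter> e = {}) \<longleftrightarrow> (\<forall>v \<in> fc \<union> lc. \<forall>e \<in> R. v \<notin> e)"
      unfolding glue_vertex_eq cut_points_Un[symmetric] by auto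
    moreover have "(\<forall>v \<in> snake_vertices u. if v \<in> fc \<union> lc then A v else B v) \<longleftrightarrow>
        (\<forall>v \<in> fc \<union> lc. A v) \<and> (\<forall>v \<in> snake_vertices u - (fc \<union> lc). B v)" for A B
      by (rule ball_if_mem[OF cut_vertices])
    ultimately show ?thesis by simp
  qed
  also have "\<dots> \<longleftrightarrow> snake_matching u (R \<union> {fc, lc})"
    using snake_matching_split[OF R, of "{fc, lc}"] by simp
  finally show ?thesis .
qed

text \<open>If a matching of the band graph omits the cut edge, its two end points are covered by ordinary
edges.  By \<open>cut_points_separated\<close>, such an edge contains just one of the four points before
gluing.  That these edges lie on the same side thus means that they cover one copy of the cut edge
and avoid the other, so that the latter can be added to obtain a matching of the snake graph.\<close>

lemma good_matching_without_cut:
  assumes R: "R \<subseteq> snake_edges u - {fc, lc}"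
  shows "good_matching w ((\<lambda>e. {e}) ` R) \<longleftrightarrow> snake_matching u (R \<union> {fc}) \<or> snake_matching u (R \<union> {lc})"
proof -
  let ?X = "cut_point_x w" and ?Y = "cut_point_y w"
  let ?perfect = "\<forall>v \<in> snake_vertices u. \<exists>!e. e \<in> R \<and> glue_vertex w v \<inter> e \<noteq> {}"
  let ?side = "\<lambda>c. \<forall>e \<in> R. ?X \<inter> e \<noteq> {} \<or> ?Y \<inter> e \<noteq> {} \<longrightarrow> c \<inter> e \<noteq> {}"
  have "(\<exists>!e. e \<in> (\<lambda>e. {e}) ` R \<and> band_incident (glue_vertex w v) e) \<longleftrightarrow>
      (\<exists>!e. e \<in> R \<and> glue_vertex w v \<inter> e \<noteq> {})" for v
    unfolding ex1_singleton_image by (simp add: band_incident_def)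
  moreover have "(\<lambda>e. {e}) ` R \<subseteq> band_edges w"
    unfolding band_edges_eq using R by blast
  moreover have "cut_edge w \<notin> (\<lambda>e. {e}) ` R" using single_neq_cut_edge by blast
  moreover have "same_side w ((\<lambda>e. {e}) ` R) \<longleftrightarrow> ?side fc \<or> ?side lc"
    by (simp add: same_side_def band_incident_def)
  ultimately have good: "good_matching w ((\<lambda>e. {e}) ` R) \<longleftrightarrow> ?perfect \<and> (?side fc \<or> ?side lc)"
    unfolding good_matching_def perfect_matching_def band_vertices_def ball_simps by simp
  have separated: "p = q" if "e \<in> R" "p \<in> e" "q \<in> e" "p \<in> ?X \<union> ?Y" "q \<in> ?X \<union> ?Y" for e p q
    using cut_points_separated[of e p q] that R unfolding cut_points_Un by blast
  \<comment> \<open>The situation is symmetric in the two copies of the cut edge: \<open>c\<close> is the copy met by the matching, \<open>d\<close> is the one to be added.\<close>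
  have one_side: "?perfect \<and> ?side c \<longleftrightarrow> snake_matching u (R \<union> {d})"
    if c: "c = {x, y}" and d: "d = {x', y'}" and X: "?X = {x, x'}" and Y: "?Y = {y, y'}"
      and cd: "{c, d} = {fc, lc}" for c d x y x' y'
  proof -
    have "c \<inter> d = {}" using cd cuts_disjoint by (auto simp: doubleton_eq_iff)
    have Un: "?X \<union> ?Y = c \<union> d" unfolding c d X Y by blast
    have vertices: "c \<union> d \<subseteq> snake_vertices u" using Un cut_points_Un cut_vertices by simp
    have glue: "glue_vertex w x = ?X" "glue_vertex w y = ?Y" "v \<notin> c \<union> d \<Longrightarrow> glue_vertex w v = {v}" for v
      using cut_points_disjoint Un unfolding glue_vertex_eq X Y by auto
    have snake: "snake_matching u (R \<union> {d}) \<longleftrightarrow>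
        (\<forall>v \<in> snake_vertices u. if v \<in> d then \<forall>e \<in> R. v \<notin> e else \<exists>!e. e \<in> R \<and> v \<in> e)"
    proof -
      have "{d} \<subseteq> {fc, lc}" using cd by auto
      from snake_matching_split[OF R this] show ?thesis by simp
    qed
    show ?thesis
    proof
      assume L: "?perfect \<and> ?side c"
      have avoid: "v \<notin> e" if "v \<in> d" "e \<in> R" for v e
      proof
        assume "v \<in> e"
        have "v \<in> ?X \<union> ?Y" using that Un by blast
        then have "c \<inter> e \<noteq> {}" using L that \<open>v \<in> e\<close> by blast
        then obtain p where p: "p \<in> c" "p \<in> e" by blast
        then have "p \<in> ?X \<union> ?Y" using Un by blast
        then have "p = v" using separated[of e p v] \<open>v \<in> e\<close> \<open>v \<in> ?X \<union> ?Y\<close> that p by blast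
        then show False using \<open>c \<inter> d = {}\<close> p that by blast
      qed
      have once: "\<exists>!e. e \<in> R \<and> v \<in> e" if v: "v \<in> snake_vertices u" "v \<notin> d" for v
      proof -
        have eq: "e \<in> R \<and> glue_vertex w v \<inter> e \<noteq> {} \<longleftrightarrow> e \<in> R \<and> v \<in> e" for e
          using avoid[of x' e] avoid[of y' e] glue v X Y c d by (cases "v \<in> c") auto
        have "\<exists>!e. e \<in> R \<and> glue_vertex w v \<inter> e \<noteq> {}"
          by (rule bspec[OF conjunct1[OF L] v(1)])
        then show ?thesis unfolding eq .
      qed
      show "snake_matching u (R \<union> {d})" unfolding snake using avoid once by simp
    next
      assume "snake_matching u (R \<union> {d})"
      then have avoid: "\<And>v e. v \<in> d \<Longrightarrow> e \<in> R \<Longrightarrow> v \<notin> e"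
        and once: "\<And>v. v \<in> snake_vertices u \<Longrightarrow> v \<notin> d \<Longrightarrow> \<exists>!e. e \<in> R \<and> v \<in> e"
        using vertices unfolding snake by (auto split: if_splits)
      have meets: "?X \<inter> e \<noteq> {} \<longleftrightarrow> x \<in> e" "?Y \<inter> e \<noteq> {} \<longleftrightarrow> y \<in> e" if "e \<in> R" for e
        using avoid[of x' e] avoid[of y' e] that unfolding X Y d by auto
      have perfect: "\<exists>!e. e \<in> R \<and> glue_vertex w v \<inter> e \<noteq> {}" if v: "v \<in> snake_vertices u" for v
      proof -
        have "x \<in> c" "y \<in> c" unfolding c by simp_all
        then have xy: "x \<in> snake_vertices u" "y \<in> snake_vertices u" "x \<notin> d" "y \<notin> d"
          using vertices \<open>c \<inter> d = {}\<close> by blast+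
        consider "v \<in> ?X" | "v \<in> ?Y" "v \<notin> ?X" | "v \<notin> c \<union> d" using Un by blast
        then show ?thesis
        proof cases
          case 1
          then have eq: "e \<in> R \<and> glue_vertex w v \<inter> e \<noteq> {} \<longleftrightarrow> e \<in> R \<and> x \<in> e" for e
            using meets by (auto simp: glue_vertex_eq)
          show ?thesis unfolding eq by (rule once[OF xy(1,3)])
        next
          case 2
          then have eq: "e \<in> R \<and> glue_vertex w v \<inter> e \<noteq> {} \<longleftrightarrow> e \<in> R \<and> y \<in> e" for e
            using meets by (auto simp: glue_vertex_eq)
          show ?thesis unfolding eq by (rule once[OF xy(2,4)])
        next
          case 3
          then show ?thesis using glue(3) once v by simp
        qed
      qed
      have side: "?side c" using meets c by auto
      show "?perfect \<and> ?side c" by (rule conjI[OF ballI[OF perfect] side])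
    qed
  qed
  have last: "?perfect \<and> ?side fc \<longleftrightarrow> snake_matching u (R \<union> {lc})"
    by (rule one_side[OF first_cut_eq last_cut_eq cut_point_x_eq cut_point_y_eq refl])
  have first: "?perfect \<and> ?side lc \<longleftrightarrow> snake_matching u (R \<union> {fc})"
    by (rule one_side[OF last_cut_eq first_cut_eq]) (use cut_point_x_eq cut_point_y_eq in auto)
  show ?thesis unfolding good conj_disj_distribL last first by (rule disj_commute)
qed

lemma good_matching_glue_matching:
  assumes "snake_matching u P" "contains_cut w P"
  shows "good_matching w (glue_matching w P)"
proof -
  let ?R = "P - {fc, lc}"
  have R: "?R \<subseteq> snake_edges u - {fc, lc}"
    using assms(1) unfolding snake_matching_def perfect_matching_def by blast
  consider "P = ?R \<union> {fc, lc}" | "P = ?R \<union> {fc}" "lc \<notin> P" | "P = ?R \<union> {lc}" "fc \<notin> P"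
    using assms(2) unfolding contains_cut_def by blast
  then show ?thesis
  proof cases
    case 1
    then have "glue_matching w P = insert (cut_edge w) ((\<lambda>e. {e}) ` ?R)"
      unfolding glue_matching_def by auto
    then show ?thesis using good_matching_with_cut[OF R] assms(1) 1 by simp
  next
    case 2
    then have "glue_matching w P = (\<lambda>e. {e}) ` ?R" unfolding glue_matching_def by auto
    then show ?thesis using good_matching_without_cut[OF R] assms(1) 2(1) by metis
  next
    case 3
    then have "glue_matching w P = (\<lambda>e. {e}) ` ?R" unfolding glue_matching_def by auto
    then show ?thesis using good_matching_without_cut[OF R] assms(1) 3(1) by metis
  qed
qed

lemma good_matching_is_glue_matching:
  assumes good: "good_matching w P"
  shows "\<exists>P'. snake_matching u P' \<and> contains_cut w P' \<and> P = glue_matching w P'"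
proof -
  define R where "R = {e. {e} \<in> P} - {fc, lc}"
  have "P \<subseteq> band_edges w" using good by (simp add: good_matching_def perfect_matching_def)
  then have R: "R \<subseteq> snake_edges u - {fc, lc}" and P: "P - {cut_edge w} = (\<lambda>e. {e}) ` R"
    using single_neq_cut_edge unfolding band_edges_eq R_def by auto
  have glue: "glue_matching w (R \<union> A) = (\<lambda>e. {e}) ` R \<union> (if {fc, lc} \<subseteq> A then {cut_edge w} else {})"
    if "A \<subseteq> {fc, lc}" for A
    using that R unfolding glue_matching_def by auto
  show ?thesis
  proof (cases "cut_edge w \<in> P")
    case True
    then have "P = insert (cut_edge w) (P - {cut_edge w})" by (simp only: insert_Diff)
    then have "P = insert (cut_edge w) ((\<lambda>e. {e}) ` R)" unfolding P .
    moreover from this have "snake_matching u (R \<union> {fc, lc})"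
      using good good_matching_with_cut[OF R] by simp
    ultimately show ?thesis
      using glue[of "{fc, lc}"] by (intro exI[of _ "R \<union> {fc, lc}"]) (simp add: contains_cut_def)
  next
    case False
    then have P: "P = (\<lambda>e. {e}) ` R" using P by simp
    then consider "snake_matching u (R \<union> {fc})" | "snake_matching u (R \<union> {lc})"
      using good good_matching_without_cut[OF R] by blast
    then show ?thesis
    proof cases
      case 1
      then show ?thesis
        using glue[of "{fc}"] cuts_neq P by (intro exI[of _ "R \<union> {fc}"]) (simp add: contains_cut_def)
    next
      case 2
      then show ?thesis
        using glue[of "{lc}"] cuts_neq P by (intro exI[of _ "R \<union> {lc}"]) (simp add: contains_cut_def)
    qed
  qed
qed

text \<open>The origin lies on the first copy of the cut edge only.  If this copy is not in the matching, another
edge covers the origin, and this edge is not a copy of the cut edge.\<close>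

lemma snake_matching_cut_determined:
  assumes "snake_matching u P" "snake_matching u P'" "P - {fc, lc} = P' - {fc, lc}" "fc \<notin> P"
  shows "fc \<notin> P'"
proof
  assume "fc \<in> P'"
  have O: "(0, 0) \<in> snake_vertices u" "(0, 0) \<in> fc" "(0, 0) \<notin> lc"
    using cut_vertices cuts_disjoint first_cut_eq by auto
  then obtain e where e: "e \<in> P" "(0, 0) \<in> e"
    using assms(1) unfolding snake_matching_def perfect_matching_def by blast
  then have "e \<in> P - {fc, lc}" using O assms(4) by auto
  then have "e \<in> P'" "e \<noteq> fc" using assms(3) by auto
  moreover from this(1) have "fc = e"
    by (rule snake_matching_unique[OF assms(2) O(1) \<open>fc \<in> P'\<close> _ O(2) e(2)])
  ultimately show False by simp
qed

lemma cut_matching_glue_matching: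
  assumes P: "snake_matching u P" and cut: "contains_cut w P"
  shows "cut_matching w (glue_matching w P) = P"
proof -
  have sub: "P \<subseteq> snake_edges u"
    using P unfolding snake_matching_def perfect_matching_def by blast
  have "cut_edge w \<notin> (\<lambda>e. {e}) ` A" for A using single_neq_cut_edge by blast
  then have cut_mem: "cut_edge w \<in> glue_matching w P \<longleftrightarrow> fc \<in> P \<and> lc \<in> P"
    unfolding glue_matching_def by simp
  have single: "{e} \<in> glue_matching w P \<longleftrightarrow> e \<in> P" "glue_edge w e = {e}" if "e \<notin> {fc, lc}" for e
    using that single_neq_cut_edge[of e] unfolding glue_matching_def glue_edge_def by auto
  have rest: "{e \<in> snake_edges u. glue_edge w e \<in> glue_matching w P} - {fc, lc} = P - {fc, lc}"
  proof (rule Set.set_eqI)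
    show "e \<in> {e \<in> snake_edges u. glue_edge w e \<in> glue_matching w P} - {fc, lc} \<longleftrightarrow> e \<in> P - {fc, lc}" for e
    proof (cases "e \<in> {fc, lc}")
      case False
      have "e \<in> P \<Longrightarrow> e \<in> snake_edges u" using sub by (rule subsetD)
      then show ?thesis using False single[OF False] by auto
    qed simp
  qed
  show ?thesis
    unfolding cut_matching_def cut_mem rest
  proof (rule the_equality)
    show "snake_matching u P \<and> (fc \<in> P \<or> lc \<in> P) \<and> P - {fc, lc} = P - {fc, lc} \<and>
        (fc \<in> P \<and> lc \<in> P \<longleftrightarrow> fc \<in> P \<and> lc \<in> P)"
      using P cut by (simp add: contains_cut_def)
  next
    fix P' assume P': "snake_matching u P' \<and> (fc \<in> P' \<or> lc \<in> P') \<and> P' - {fc, lc} = P - {fc, lc} \<and>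
        (fc \<in> P \<and> lc \<in> P \<longleftrightarrow> fc \<in> P' \<and> lc \<in> P')"
    then have m: "snake_matching u P'" and rest_eq: "P' - {fc, lc} = P - {fc, lc}"
      and some: "fc \<in> P' \<or> lc \<in> P'" and both: "fc \<in> P \<and> lc \<in> P \<longleftrightarrow> fc \<in> P' \<and> lc \<in> P'"
      by simp_all
    have fc_iff: "fc \<in> P \<longleftrightarrow> fc \<in> P'"
      using snake_matching_cut_determined[OF P m rest_eq[symmetric]] snake_matching_cut_determined[OF m P rest_eq]
      by argo
    with both some cut have "lc \<in> P \<longleftrightarrow> lc \<in> P'" unfolding contains_cut_def by argo
    with fc_iff have "P' \<inter> {fc, lc} = P \<inter> {fc, lc}" by auto
    with rest_eq show "P' = P" by (metis Un_Diff_Int)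
  qed
qed

lemma contains_cut_ideal_matching:
  "contains_cut w (ideal_matching u H) \<longleftrightarrow> (0 \<in> H \<longleftrightarrow> closing) \<or> (n \<in> H \<longleftrightarrow> \<not> closing)"
  unfolding contains_cut_def first_cut_eq last_cut_eq bottom_mem_ideal_matching top_mem_ideal_matching
  by (cases closing; cases "even n") simp_all

text \<open>Closedness under the last letter says that the first index is in \<open>H\<close> or the last one is
not, or conversely if the last letter is an inverse arrow; this is the presence of a copy of the cut
edge.\<close>

lemma cyclic_ideals_iff:
  "H \<in> cyclic_ideals w \<longleftrightarrow> H \<in> string_ideals u \<and> contains_cut w (ideal_matching u H)"
proof -
  have "(\<forall>k < length w. from_index w k \<in> H \<longrightarrow> to_index w k \<in> H) \<longleftrightarrow>
      (\<forall>k < n. from_index w k \<in> H \<longrightarrow> to_index w k \<in> H) \<and> (from_index w n \<in> H \<longrightarrow> to_index w n \<in> H)"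
    unfolding length_w by (auto simp: less_Suc_eq)
  moreover have "from_index w n = (if closing then n else 0)" "to_index w n = (if closing then 0 else n)"
    by (simp_all add: from_index_def to_index_def next_index_def nth_closing length_w)
  moreover have "from_index w k = (if snd (u ! k) then k else Suc k)" "to_index w k = (if snd (u ! k) then Suc k else k)"
    if "k < n" for k
    using that by (simp_all add: from_index_def to_index_def next_index_def nth_butlast length_w)
  moreover have "{..<length w} = {..n}" unfolding length_w by (rule lessThan_Suc_atMost)
  ultimately show ?thesis
    unfolding cyclic_ideals_def string_ideals_def contains_cut_ideal_matching mem_Collect_eq by auto
qed

lemma good_matching_lattice_represented:
  "set_represented_lattice (good_matching_lattice w) (\<lambda>P. enclosed_tiles u (cut_matching w P)) (cyclic_ideals w)"
proof -
  let ?h = "\<lambda>P. enclosed_tiles u (cut_matching w P)" and ?g = "\<lambda>H. glue_matching w (ideal_matching u H)"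
  have of_ideal: "good_matching w (?g H)" "?h (?g H) = H" if "H \<in> cyclic_ideals w" for H
    using that unfolding cyclic_ideals_iff
    by (simp_all add: snake_matching_ideal_matching good_matching_glue_matching
        cut_matching_glue_matching enclosed_tiles_ideal_matching)
  have to_ideal: "\<exists>H \<in> cyclic_ideals w. P = ?g H" if "good_matching w P" for P
    using good_matching_is_glue_matching[OF that] snake_matching_is_ideal_matching cyclic_ideals_iff by metis
  have of_good: "?h P \<in> cyclic_ideals w \<and> ?g (?h P) = P" if good: "good_matching w P" for P
  proof -
    obtain H where H: "H \<in> cyclic_ideals w" "P = ?g H" using to_ideal[OF good] by blast
    then show ?thesis using of_ideal(2)[OF H(1)] by simp
  qed
  have bound: "?h P \<subseteq> {..<length w}" if "good_matching w P" for P
    using of_good[OF that] by (simp add: cyclic_ideals_def)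
  show ?thesis
  proof
    show "bij_betw ?h (carrier (good_matching_lattice w)) (cyclic_ideals w)"
      using of_ideal of_good
      by (intro bij_betw_byWitness[where f' = ?g]) (auto simp: good_matching_lattice_def)
    show "le (good_matching_lattice w) P P' \<longleftrightarrow> ?h P \<subseteq> ?h P'"
      if "P \<in> carrier (good_matching_lattice w)" "P' \<in> carrier (good_matching_lattice w)" for P P'
      using bound[of P] that by (auto simp: good_matching_lattice_def height_def)
  qed (simp_all add: good_matching_lattice_def cyclic_ideals_Un cyclic_ideals_Int)
qed

end

theorem theorem9:
  fixes Q :: "('v, 'a) pre_digraph"
    and I :: "('v \<times> 'a list \<Rightarrow> 'k::alg_closed_field) set"
    and w :: "'a letter list"
    and lam :: 'k
  assumes "gentle_pair Q I"
    and "is_band Q I w"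
    and "lam \<noteq> 0"
  shows "\<exists>f. lattice_bijection (good_matching_lattice w) (canonical_submodule_lattice Q w lam) f"
proof -
  interpret gentle_pair Q I by fact
  interpret mixed_word w
    using band_has_both_signs[OF assms(1,2)] by unfold_locales
  show ?thesis
    using good_matching_lattice_represented
      canonical_submodule_lattice_represented[OF wf_digraph_axioms assms(2,3)]
    by (rule lattice_bijection_if_same_representation)
qed

end
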